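(* Let $p$ be a prime, let $L$ be a field of characteristic $p$ with a fixed algebraic closure $\overline{L}$, and let $\overline{\mathbb{F}}_p$ denote the algebraic closure of $\mathbb{F}_p$ inside $\overline{L}$. Let $f(x)=c_1x^{d_1}+c_2x^{d_2}\in\overline{\mathbb{F}}_p[x]$ with $c_1,c_2\in\overline{\mathbb{F}}_p^*$, $1\le d_1<d_2$, and write $d_i=p^{\ell_i}s_i$ with integers $\ell_i\ge0$ and $p\nmid s_i$. Assume $s_1\ge3$ and $s_2=1$. Let $\alpha,\beta\in L$. Then $\mathrm{Prep}(f;\alpha,\beta)$ is infinite if and only if $\alpha,\beta\in\overline{\mathbb{F}}_p$ or $f(\alpha)=f(\beta)$.
   Context: For $\lambda\in\overline{L}$ let $f_\lambda(x):=f(x)+\lambda$. An element is preperiodic under $f_\lambda$ if its forward orbit under $f_\lambda$ is finite. $\mathrm{Prep}(f;\alpha,\beta)$ is the set of $\lambda\in\overline{L}$ such that both $\alpha$ and $\beta$ are preperiodic under $f_\lambda$. *)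

theory Defs
  imports "HOL-Computational_Algebra.Computational_Algebra"
begin

definition algebraic_over :: "'k::field set \<Rightarrow> 'k \<Rightarrow> bool" where
  "algebraic_over F x \<longleftrightarrow> (\<exists>q. q \<noteq> 0 \<and> (\<forall>i. coeff q i \<in> F) \<and> poly q x = 0)"

text \<open>
  The field \<open>'k\<close>, together with the embedding \<open>\<iota>\<close>, is an algebraic closure of \<open>'l\<close>;
  that \<open>'k\<close> is algebraically closed is expressed by its type class.
\<close>

definition algebraic_closure_map :: "('l::field \<Rightarrow> 'k::alg_closed_field) \<Rightarrow> bool" where
  "algebraic_closure_map \<iota> \<longleftrightarrow>
     \<iota> 1 = 1 \<and>
     (\<forall>x y. \<iota> (x + y) = \<iota> x + \<iota> y) \<and>
     (\<forall>x y. \<iota> (x * y) = \<iota> x * \<iota> y) \<and>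
     (\<forall>z. algebraic_over (range \<iota>) z)"

text \<open>
  In a field of prime characteristic \<open>p\<close> the set \<open>\<int>\<close>, i.e. the range of \<^const>\<open>of_int\<close>, is the
  prime field with \<open>p\<close> elements, so this is its algebraic closure inside \<open>'k\<close>.
\<close>

definition Fp_bar :: "'k::field set" where
  "Fp_bar = {x. algebraic_over \<int> x}"

definition preperiodic :: "('k \<Rightarrow> 'k) \<Rightarrow> 'k \<Rightarrow> bool" where
  "preperiodic g x \<longleftrightarrow> finite (range (\<lambda>n. (g ^^ n) x))"

definition Prep :: "'k::field poly \<Rightarrow> 'k \<Rightarrow> 'k \<Rightarrow> 'k set" where
  "Prep f a b = {t. preperiodic (\<lambda>x. poly f x + t) a \<and> preperiodic (\<lambda>x. poly f x + t) b}"

end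

theory Submission
  imports Defs "HOL-Algebra.Exponent"
begin

text \<open>
  Write \<open>f = g\<^sup>e\<close> with \<open>g = z x\<^sup>Q + u x\<^sup>s\<close>, where \<open>e = p ^ l1\<close>, \<open>Q = p ^ (l2 - l1)\<close> and
  \<open>s = s1\<close>, and let \<open>\<gamma> = f(\<alpha>) - f(\<beta>)\<close>. Consider all valuation rings containing
  the algebraic closure of the prime field.

  At a place where \<open>\<alpha>\<close> is integral, \<open>\<beta>\<close> and all \<open>\<lambda>\<close> in the set \<open>Prep\<close> are integral. At a
  pole of \<open>\<alpha>\<close>, all points of both orbits have the absolute value of \<open>\<alpha>\<close>. Let \<open>W > 1\<close> be given by
  \<open>W\<^bsup>Q-1\<^esup> = \<bar>\<alpha>\<bar>\<^bsup>s-1\<^esup>\<close>. The differences \<open>\<lambda> - \<lambda>'\<close> of parameters and \<open>\<gamma>\<close> have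
  absolute value either \<open>W\<close> or at most \<open>W\<^bsup>-(Q-2)\<^esup>\<close>, so that the parameters fall into clusters. There
  are at most \<open>Q\<close> clusters, and if \<open>\<bar>\<gamma>\<bar> = W\<close> then there are at most \<open>P\<close> of them, where \<open>P \<le> Q/2\<close> is
  the largest power of \<open>p\<close> dividing \<open>s - 1\<close>.

  For \<open>3 Q\<close> distinct parameters, this makes the product of a power of \<open>\<gamma>\<close> with all differences of the
  parameters integral everywhere and smaller than 1 at every pole of \<open>\<alpha>\<close>. An element that is
  integral everywhere is algebraic over the prime field, so the product vanishes and \<open>\<gamma> = 0\<close>.

  Conversely, if \<open>\<alpha>\<close> is transcendental, the equations \<open>f\<^sub>\<lambda>\<^sup>n(\<alpha>) = \<alpha>\<close> are separable
  in \<open>\<lambda>\<close>, because at a pole of \<open>\<alpha>\<close> the derivative of \<open>f\<close> along the orbit is \<open>0\<close> or larger than 1.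
\<close>

section \<open>The algebraic closure of the prime field\<close>

lemma frobenius_diff:
  fixes x y :: "'a::comm_ring_1"
  assumes "prime p" "CHAR('a) = p"
  shows "(x - y) ^ (p ^ n) = x ^ (p ^ n) - y ^ (p ^ n)"
proof -
  have "((x - y) + y) ^ (p ^ n) = (x - y) ^ (p ^ n) + y ^ (p ^ n)"
    using freshmans_dream'[of "p ^ n" n "x - y" y] assms by auto
  thus ?thesis by (simp add: eq_diff_eq)
qed

lemma frobenius_inj:
  fixes x y :: "'a::field"
  assumes "prime p" "CHAR('a) = p" "x ^ (p ^ n) = y ^ (p ^ n)"
  shows "x = y"
proof -
  have "(x - y) ^ (p ^ n) = 0"
    using frobenius_diff[OF assms(1,2), of x y n] assms(3) by simp
  thus ?thesis by simp
qed

lemma power_fixed_iterate: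
  fixes x :: "'a::monoid_mult"
  assumes "x ^ q = x"
  shows "x ^ (q ^ j) = x"
  by (induction j) (use assms in \<open>simp_all add: power_mult\<close>)

text \<open>The \<open>p ^ n\<close>-power map fixes the coefficients of \<open>h\<close>, hence
  sends roots to roots. Finiteness of the root set makes two Frobenius iterates of \<open>x\<close>
  agree, and injectivity of Frobenius cancels the smaller exponent.\<close>

lemma frobenius_fixed_poly_root:
  fixes x :: "'a::field"
  assumes p: "prime p" "CHAR('a) = p" and n: "n > 0"
    and h: "h \<noteq> 0" "poly h x = 0" and fixed: "\<And>i. coeff h i ^ (p ^ n) = coeff h i"
  shows "\<exists>m>0. x ^ (p ^ m) = x"
proof -
  have root: "poly h (x ^ (p ^ (n * i))) = 0" for i
  proof (induction i)
    case 0
    show ?case using h by simp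
  next
    case (Suc i)
    let ?y = "x ^ (p ^ (n * i))"
    have "0 = (poly h ?y) ^ (p ^ n)" using Suc p by (simp add: prime_gt_0_nat)
    also have "\<dots> = (\<Sum>j\<le>degree h. (coeff h j * ?y ^ j) ^ (p ^ n))"
      unfolding poly_altdef by (rule freshmans_dream_sum'[where n = n]) (use p in auto)
    also have "\<dots> = (\<Sum>j\<le>degree h. coeff h j * (?y ^ (p ^ n)) ^ j)"
      by (intro sum.cong refl)
        (simp add: power_mult_distrib fixed mult.commute mult.left_commute flip: power_mult)
    also have "\<dots> = poly h (x ^ (p ^ (n * Suc i)))"
      by (simp add: poly_altdef power_add mult.commute flip: power_mult)
    finally show ?case by simp
  qed
  have "finite {y. poly h y = 0}" using h(1) by (rule poly_roots_finite)
  hence "finite (range (\<lambda>i. x ^ (p ^ (n * i))))"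
    by (rule finite_subset[rotated]) (use root in auto)
  hence "\<not> inj (\<lambda>i::nat. x ^ (p ^ (n * i)))"
    using finite_imageD infinite_UNIV_nat by blast
  then obtain i' j' where ij': "i' \<noteq> j'" "x ^ (p ^ (n * i')) = x ^ (p ^ (n * j'))"
    by (auto simp: inj_on_def)
  obtain i j where ij: "i < j" "x ^ (p ^ (n * i)) = x ^ (p ^ (n * j))"
    using ij' by (cases "i' < j'") (use linorder_neqE_nat in metis, metis linorder_neqE_nat)
  have "(x ^ (p ^ (n * (j - i)))) ^ (p ^ (n * i)) = x ^ (p ^ (n * i))"
    using ij by (simp flip: power_mult power_add add: diff_mult_distrib2)
  hence "x ^ (p ^ (n * (j - i))) = x" by (rule frobenius_inj[OF p])
  thus ?thesis using ij n by (intro exI[of _ "n * (j - i)"]) auto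
qed

text \<open>Fermat's little theorem: reduce the integer modulo \<open>p\<close>, then induct with
  the freshman's dream.\<close>

lemma Ints_power_char:
  fixes x :: "'a::field"
  assumes p: "prime p" "CHAR('a) = p" and "x \<in> \<int>"
  shows "x ^ p = x"
proof -
  obtain k where k: "x = of_int k" using assms(3) Ints_cases by blast
  define m where "m = nat (k mod int p)"
  have "of_int (int m) = (of_int k :: 'a)"
  proof -
    have "of_int k = (of_int (int p * (k div int p) + k mod int p) :: 'a)" by simp
    also have "\<dots> = of_nat p * of_int (k div int p) + of_int (k mod int p)"
      by (simp only: of_int_add of_int_mult of_int_of_nat_eq)
    also have "of_nat p = (0::'a)" using p(2) by (metis of_nat_CHAR)
    finally show ?thesis using p by (simp add: m_def prime_gt_0_nat)
  qed
  hence x: "x = of_nat m" using k by simp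
  have "(of_nat m :: 'a) ^ p = of_nat m"
  proof (induction m)
    case 0
    show ?case using p by (simp add: prime_gt_0_nat)
  next
    case (Suc m)
    have "(1 + of_nat m :: 'a) ^ p = 1 ^ p + of_nat m ^ p"
      by (rule freshmans_dream) (use p in auto)
    thus ?case using Suc by simp
  qed
  thus ?thesis using x by simp
qed

lemma Fp_bar_iff:
  fixes x :: "'a::field"
  assumes p: "prime p" "CHAR('a) = p"
  shows "x \<in> Fp_bar \<longleftrightarrow> (\<exists>n>0. x ^ (p ^ n) = x)"
proof
  assume "x \<in> Fp_bar"
  then obtain q where "q \<noteq> 0" "\<And>i. coeff q i \<in> \<int>" "poly q x = 0"
    by (auto simp: Fp_bar_def algebraic_over_def)
  thus "\<exists>n>0. x ^ (p ^ n) = x"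
    using frobenius_fixed_poly_root[OF p, of 1 q x] Ints_power_char[OF p] by auto
next
  assume "\<exists>n>0. x ^ (p ^ n) = x"
  then obtain n where n: "n > 0" "x ^ (p ^ n) = x" by blast
  define q :: "'a poly" where "q = monom 1 (p ^ n) - monom 1 1"
  have "p ^ n > 1" using one_less_power[OF prime_gt_1_nat[OF p(1)] n(1)] .
  hence "coeff q (p ^ n) = 1" by (simp add: q_def)
  hence "q \<noteq> 0" by auto
  moreover have "coeff q i \<in> \<int>" for i by (auto simp: q_def)
  moreover have "poly q x = 0" using n by (simp add: q_def poly_monom)
  ultimately show "x \<in> Fp_bar" by (auto simp: Fp_bar_def algebraic_over_def)
qed

text \<open>Exponents are merged by multiplication. A single Frobenius power fixing all elements
  involved reduces the closure properties of \<open>Fp_bar\<close> to direct computations.\<close>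

lemma Fp_bar_common_fixed:
  fixes A :: "'a::field set"
  assumes p: "prime p" "CHAR('a) = p" and A: "finite A" "A \<subseteq> Fp_bar"
  shows "\<exists>n>0. \<forall>x\<in>A. x ^ (p ^ n) = x"
  using A
proof (induction A rule: finite_induct)
  case empty
  show ?case by auto
next
  case (insert a A)
  then obtain n where n: "n > 0" "\<forall>x\<in>A. x ^ (p ^ n) = x" by auto
  obtain m where m: "m > 0" "a ^ (p ^ m) = a" using insert.prems Fp_bar_iff[OF p] by auto
  have "x ^ (p ^ (n * m)) = x" if "x \<in> insert a A" for x
  proof (cases "x = a")
    case True
    thus ?thesis using power_fixed_iterate[OF m(2), of n] by (simp add: mult.commute flip: power_mult)
  next
    case False
    hence "x ^ (p ^ n) = x" using that n by auto
    thus ?thesis using power_fixed_iterate[of x "p ^ n" m] by (simp flip: power_mult)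
  qed
  thus ?case using n m by (intro exI[of _ "n * m"]) auto
qed

lemma Fp_bar_algebraically_closed:
  fixes x :: "'a::field"
  assumes p: "prime p" "CHAR('a) = p"
    and "h \<noteq> 0" "\<And>i. coeff h i \<in> Fp_bar" "poly h x = 0"
  shows "x \<in> Fp_bar"
proof -
  obtain n where n: "n > 0" "\<forall>c \<in> set (coeffs h). c ^ (p ^ n) = c"
    using Fp_bar_common_fixed[OF p, of "set (coeffs h)"] assms(4)
    by (auto simp: coeffs_def assms(3))
  have "coeff h i ^ (p ^ n) = coeff h i" for i
    using n p by (cases "i \<le> degree h") (auto simp: coeff_eq_0 prime_gt_0_nat coeffs_def assms(3))
  thus ?thesis using frobenius_fixed_poly_root[OF p n(1) assms(3,5)] Fp_bar_iff[OF p] by auto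
qed

lemma Fp_bar_subfield:
  fixes x y :: "'a::field"
  assumes p: "prime p" "CHAR('a) = p"
  shows Fp_bar_0: "0 \<in> (Fp_bar :: 'a set)" and Fp_bar_1: "1 \<in> (Fp_bar :: 'a set)"
    and Fp_bar_diff: "x \<in> Fp_bar \<Longrightarrow> y \<in> Fp_bar \<Longrightarrow> x - y \<in> Fp_bar"
    and Fp_bar_mult: "x \<in> Fp_bar \<Longrightarrow> y \<in> Fp_bar \<Longrightarrow> x * y \<in> Fp_bar"
    and Fp_bar_inverse: "x \<in> Fp_bar \<Longrightarrow> inverse x \<in> Fp_bar"
proof -
  have common: "\<exists>n>0. x ^ (p ^ n) = x \<and> y ^ (p ^ n) = y" if "x \<in> Fp_bar" "y \<in> Fp_bar" for x y :: 'a
    using Fp_bar_common_fixed[OF p, of "{x, y}"] that by auto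
  show "0 \<in> (Fp_bar :: 'a set)" "1 \<in> (Fp_bar :: 'a set)"
    using p by (auto simp: Fp_bar_iff[OF p] prime_gt_0_nat intro!: exI[of _ 1])
  have Fp_barI: "x \<in> Fp_bar" if "n > 0" "x ^ (p ^ n) = x" for x :: 'a and n
    using that Fp_bar_iff[OF p] by blast
  {
    assume "x \<in> Fp_bar" "y \<in> Fp_bar"
    then obtain n where n: "n > 0" "x ^ (p ^ n) = x" "y ^ (p ^ n) = y" using common by blast
    have "(x - y) ^ (p ^ n) = x - y" using frobenius_diff[OF p, of x y n] n by simp
    thus "x - y \<in> Fp_bar" by (rule Fp_barI[OF n(1)])
    have "(x * y) ^ (p ^ n) = x * y" using n by (simp add: power_mult_distrib)
    thus "x * y \<in> Fp_bar" by (rule Fp_barI[OF n(1)])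
  }
  assume "x \<in> Fp_bar"
  then obtain n where n: "n > 0" "x ^ (p ^ n) = x" using common by blast
  have "inverse x ^ (p ^ n) = inverse x" using n by (simp add: power_inverse)
  thus "inverse x \<in> Fp_bar" by (rule Fp_barI[OF n(1)])
qed

text \<open>The polynomial splits, and a linear factor occurring twice would also divide the
  derivative; so every multiplicity is 1.\<close>

lemma card_roots_separable:
  fixes h :: "'a::alg_closed_field poly"
  assumes "h \<noteq> 0" and sep: "\<And>x. poly h x = 0 \<Longrightarrow> poly (pderiv h) x \<noteq> 0"
  shows "card {x. poly h x = 0} = degree h"
proof -
  obtain A where A: "size A = degree h" "h = smult (lead_coeff h) (\<Prod>x\<in>#A. [:- x, 1:])"
    using alg_closed_imp_factorization[OF assms(1)] by blast
  have roots: "{x. poly h x = 0} = set_mset A"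
    by (subst A(2)) (use assms(1) in \<open>auto simp: poly_prod_mset prod_mset_zero_iff\<close>)
  have "count A x \<le> 1" for x
  proof (rule ccontr)
    assume "\<not> count A x \<le> 1"
    hence "{#x, x#} \<subseteq># A" by (auto simp: subseteq_mset_def)
    then obtain B where B: "A = {#x, x#} + B" by (metis subset_mset.add_diff_inverse)
    have "h = [:- x, 1:] * ([:- x, 1:] * smult (lead_coeff h) (\<Prod>x\<in>#B. [:- x, 1:]))"
      by (subst A(2), subst B) (simp del: mult_pCons_left add: mult_ac)
    then obtain g where g: "h = [:- x, 1:] * ([:- x, 1:] * g)" by blast
    hence "poly h x = 0" "poly (pderiv h) x = 0"
      by (simp_all add: pderiv_mult del: mult_pCons_left)
    thus False using sep by blast
  qed
  hence "card (set_mset A) = size A"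
    unfolding size_multiset_overloaded_eq card_eq_sum
    by (intro sum.cong refl) (metis One_nat_def Suc_leI count_greater_zero_iff le_antisym)
  thus ?thesis using A(1) roots by simp
qed

lemma infinite_Fp_bar:
  assumes p: "prime p" "CHAR('a) = p"
  shows "infinite (Fp_bar :: 'a::alg_closed_field set)"
proof
  assume fin: "finite (Fp_bar :: 'a set)"
  define n where "n = card (Fp_bar :: 'a set)"
  \<comment> \<open>The derivative is -1, so \<open>q\<close> has \<open>p ^ Suc n\<close> distinct
    roots, all in \<open>Fp_bar\<close>: more than the supposed cardinality
    \<open>n\<close>.\<close>
  define q :: "'a poly" where "q = monom 1 (p ^ Suc n) - monom 1 1"
  have gt: "p ^ Suc n > Suc n"
    using prime_gt_1_nat[OF p(1)] power_gt_expt[of p "Suc n"] by simp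
  have coeff: "coeff q (p ^ Suc n) = 1" using gt by (simp add: q_def del: power_Suc)
  have "q \<noteq> 0" using coeff by auto
  have "of_nat (p ^ Suc n) = (0::'a)" using p by (simp add: of_nat_eq_0_iff_char_dvd)
  hence "pderiv q = - 1"
    unfolding q_def by (simp add: pderiv_diff pderiv_monom del: power_Suc of_nat_power)
  hence "card {x. poly q x = 0} = degree q"
    using \<open>q \<noteq> 0\<close> by (intro card_roots_separable) auto
  moreover have "degree q \<ge> p ^ Suc n" using coeff by (intro le_degree) auto
  moreover have "{x. poly q x = 0} \<subseteq> Fp_bar"
    by (auto simp: Fp_bar_iff[OF p] q_def poly_monom simp del: power_Suc intro!: exI[of _ "Suc n"])
  hence "card {x. poly q x = 0} \<le> n" unfolding n_def by (intro card_mono fin)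
  ultimately show False using gt by linarith
qed

section \<open>Valuation rings\<close>

text \<open>A valuation ring is used through its divisibility preorder: \<open>vle x y\<close> stands for
  \<open>\<bar>x\<bar> \<le> \<bar>y\<bar>\<close>, so that no value group has to be constructed.\<close>

locale valuation_ring =
  fixes V :: "'k::field set"
  assumes one_mem: "1 \<in> V"
    and diff_mem: "x \<in> V \<Longrightarrow> y \<in> V \<Longrightarrow> x - y \<in> V"
    and mult_mem: "x \<in> V \<Longrightarrow> y \<in> V \<Longrightarrow> x * y \<in> V"
    and inverse_mem: "x \<notin> V \<Longrightarrow> inverse x \<in> V"
begin

definition vle :: "'k \<Rightarrow> 'k \<Rightarrow> bool" where
  "vle x y \<longleftrightarrow> (\<exists>r\<in>V. x = r * y)"

definition vlt :: "'k \<Rightarrow> 'k \<Rightarrow> bool" where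
  "vlt x y \<longleftrightarrow> \<not> vle y x"

definition veq :: "'k \<Rightarrow> 'k \<Rightarrow> bool" where
  "veq x y \<longleftrightarrow> vle x y \<and> vle y x"

lemma zero_mem: "0 \<in> V"
  using diff_mem[OF one_mem one_mem] by simp

lemma uminus_mem: "x \<in> V \<Longrightarrow> - x \<in> V"
  using diff_mem[OF zero_mem, of x] by simp

lemma add_mem: "x \<in> V \<Longrightarrow> y \<in> V \<Longrightarrow> x + y \<in> V"
  using diff_mem[of x "- y"] uminus_mem[of y] by simp

lemma vle_1_iff: "vle x 1 \<longleftrightarrow> x \<in> V"
  by (simp add: vle_def)

lemma vle_refl [simp]: "vle x x"
  using one_mem by (force simp: vle_def)

lemma vle_trans [trans]: "vle x y \<Longrightarrow> vle y z \<Longrightarrow> vle x z"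
proof -
  assume "vle x y" "vle y z"
  then obtain r s where "r \<in> V" "s \<in> V" "x = r * y" "y = s * z" by (auto simp: vle_def)
  thus ?thesis unfolding vle_def using mult_mem by (intro bexI[of _ "r * s"]) (auto simp: mult_ac)
qed

lemma zero_vle [simp]: "vle 0 x"
  using zero_mem by (force simp: vle_def)

lemma vle_0_iff [simp]: "vle x 0 \<longleftrightarrow> x = 0"
  using zero_mem by (force simp: vle_def)

lemma vle_total: "vle x y \<or> vle y x"
proof (cases "x = 0 \<or> y = 0")
  case False
  have "x / y \<in> V \<or> y / x \<in> V" using inverse_mem[of "x / y"] by auto
  thus ?thesis using False by (force simp: vle_def)
qed auto

lemma vlt_irrefl [simp]: "\<not> vlt x x" by (simp add: vlt_def)

lemma vlt_imp_vle: "vlt x y \<Longrightarrow> vle x y"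
  using vle_total[of x y] by (auto simp: vlt_def)

lemma vle_vlt_trans [trans]: "vle x y \<Longrightarrow> vlt y z \<Longrightarrow> vlt x z"
  unfolding vlt_def using vle_trans by blast

lemma vlt_vle_trans [trans]: "vlt x y \<Longrightarrow> vle y z \<Longrightarrow> vlt x z"
  unfolding vlt_def using vle_trans by blast

lemma vlt_trans [trans]: "vlt x y \<Longrightarrow> vlt y z \<Longrightarrow> vlt x z"
  using vlt_imp_vle vle_vlt_trans by blast

lemma not_vle: "\<not> vle x y \<longleftrightarrow> vlt y x" by (simp add: vlt_def)

lemma not_vlt: "\<not> vlt x y \<longleftrightarrow> vle y x" by (simp add: vlt_def)

lemma vlt_imp_nonzero: "vlt x y \<Longrightarrow> y \<noteq> 0"
  by (auto simp: vlt_def)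

lemma zero_vlt_iff [simp]: "vlt 0 x \<longleftrightarrow> x \<noteq> 0" by (simp add: vlt_def)

lemma veqD: "veq x y \<Longrightarrow> vle x y" "veq x y \<Longrightarrow> vle y x" by (auto simp: veq_def)

lemma veq_refl [simp]: "veq x x" by (auto simp: veq_def)

lemma veq_sym: "veq x y \<Longrightarrow> veq y x" by (auto simp: veq_def)

lemma veq_trans [trans]: "veq x y \<Longrightarrow> veq y z \<Longrightarrow> veq x z"
  unfolding veq_def using vle_trans by blast

lemma vle_mult: "vle a b \<Longrightarrow> vle c d \<Longrightarrow> vle (a * c) (b * d)"
proof -
  assume "vle a b" "vle c d"
  then obtain r s where "r \<in> V" "s \<in> V" "a = r * b" "c = s * d" by (auto simp: vle_def)
  thus ?thesis unfolding vle_def using mult_mem by (intro bexI[of _ "r * s"]) (auto simp: mult_ac)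
qed

lemma veq_mult: "veq a b \<Longrightarrow> veq c d \<Longrightarrow> veq (a * c) (b * d)"
  by (simp add: veq_def vle_mult)

lemma vle_mult_cancel_right: "c \<noteq> 0 \<Longrightarrow> vle (a * c) (b * c) \<longleftrightarrow> vle a b"
  by (auto simp: vle_def)

lemma vle_mult_cancel_left: "c \<noteq> 0 \<Longrightarrow> vle (c * a) (c * b) \<longleftrightarrow> vle a b"
  using vle_mult_cancel_right[of c a b] by (simp add: mult.commute[of c])

lemma vlt_mult_cancel_right: "c \<noteq> 0 \<Longrightarrow> vlt (a * c) (b * c) \<longleftrightarrow> vlt a b"
  by (simp add: vlt_def vle_mult_cancel_right)

lemma vlt_mult_cancel_left: "c \<noteq> 0 \<Longrightarrow> vlt (c * a) (c * b) \<longleftrightarrow> vlt a b"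
  by (simp add: vlt_def vle_mult_cancel_left)

lemma vlt_vle_mult: "vlt a b \<Longrightarrow> vle c d \<Longrightarrow> d \<noteq> 0 \<Longrightarrow> vlt (a * c) (b * d)"
  using vle_vlt_trans[of "a * c" "a * d" "b * d"] vle_mult[of a a c d] vlt_mult_cancel_right[of d a b]
  by simp

lemma vle_vlt_mult: "vle a b \<Longrightarrow> vlt c d \<Longrightarrow> b \<noteq> 0 \<Longrightarrow> vlt (a * c) (b * d)"
  using vlt_vle_mult[of c d a b] by (simp add: mult.commute)

lemma vle_power: "vle a b \<Longrightarrow> vle (a ^ n) (b ^ n)"
  by (induction n) (auto intro: vle_mult)

lemma veq_power: "veq a b \<Longrightarrow> veq (a ^ n) (b ^ n)"
  by (simp add: veq_def vle_power)

lemma vlt_power: "vlt a b \<Longrightarrow> n > 0 \<Longrightarrow> vlt (a ^ n) (b ^ n)"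
proof (induction n)
  case (Suc n)
  show ?case
    using vlt_vle_mult[OF Suc.prems(1) vle_power[OF vlt_imp_vle[OF Suc.prems(1)]], of n]
      vlt_imp_nonzero[OF Suc.prems(1)] by simp
qed auto

lemma vle_power_iff: "n > 0 \<Longrightarrow> vle (a ^ n) (b ^ n) \<longleftrightarrow> vle a b"
  using vle_power[of a b n] vlt_power[of b a n] by (auto simp: vlt_def)

lemma vlt_power_iff: "n > 0 \<Longrightarrow> vlt (a ^ n) (b ^ n) \<longleftrightarrow> vlt a b"
  by (simp add: vlt_def vle_power_iff)

lemma veq_power_iff: "n > 0 \<Longrightarrow> veq (a ^ n) (b ^ n) \<longleftrightarrow> veq a b"
  by (simp add: veq_def vle_power_iff)

lemma power_vle_power: "vle 1 a \<Longrightarrow> m \<le> n \<Longrightarrow> vle (a ^ m) (a ^ n)"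
proof -
  assume a: "vle 1 a" and mn: "m \<le> n"
  have "vle (a ^ m * 1) (a ^ m * a ^ (n - m))"
    using vle_power[OF a, of "n - m"] by (intro vle_mult) auto
  thus ?thesis using mn by (simp flip: power_add)
qed

lemma power_vlt_power: "vlt 1 a \<Longrightarrow> m < n \<Longrightarrow> vlt (a ^ m) (a ^ n)"
proof -
  assume a: "vlt 1 a" and mn: "m < n"
  have "vlt (a ^ m * 1) (a ^ m * a ^ (n - m))"
    using vlt_power[OF a, of "n - m"] mn vlt_imp_nonzero[OF a] by (intro vle_vlt_mult) auto
  thus ?thesis using mn by (simp flip: power_add)
qed

lemma vle_power_self: "vle 1 a \<Longrightarrow> n > 0 \<Longrightarrow> vle a (a ^ n)"
  using power_vle_power[of a 1 n] by simp

lemma vle_uminus [simp]: "vle (- x) y \<longleftrightarrow> vle x y"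
proof -
  have "vle (- x) y" if "vle x y" for x
    using that uminus_mem unfolding vle_def by (metis minus_mult_left)
  from this[of x] this[of "- x"] show ?thesis by auto
qed

lemma vle_add: "vle a c \<Longrightarrow> vle b c \<Longrightarrow> vle (a + b) c"
proof -
  assume "vle a c" "vle b c"
  then obtain r s where "r \<in> V" "s \<in> V" "a = r * c" "b = s * c" by (auto simp: vle_def)
  thus ?thesis unfolding vle_def using add_mem by (intro bexI[of _ "r + s"]) (auto simp: distrib_right)
qed

lemma vle_diff: "vle a c \<Longrightarrow> vle b c \<Longrightarrow> vle (a - b) c"
  using vle_add[of a c "- b"] by simp

lemma vle_minus_commute: "vle (a - b) c \<longleftrightarrow> vle (b - a) c"
  using vle_uminus[of "a - b" c] by simp

lemma vlt_add: "vlt a c \<Longrightarrow> vlt b c \<Longrightarrow> vlt (a + b) c"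
  using vle_total[of a b] vle_vlt_trans[of "a + b" b c] vle_vlt_trans[of "a + b" a c]
    vle_add[of a b b] vle_add[of a a b] by auto

lemma vlt_diff: "vlt a c \<Longrightarrow> vlt b c \<Longrightarrow> vlt (a - b) c"
  using vlt_add[of a c "- b"] vle_vlt_trans[of "- b" b c] by simp

lemma vle_sum: "(\<And>i. i \<in> I \<Longrightarrow> vle (g i) c) \<Longrightarrow> vle (sum g I) c"
  by (induction I rule: infinite_finite_induct) (auto intro: vle_add)

text \<open>If \<open>a + b\<close> were smaller than \<open>a\<close>, then so would be
  \<open>a = (a + b) - b\<close>.\<close>

lemma vle_add_dominant: "vlt b a \<Longrightarrow> vle a (a + b)"
  using vlt_diff[of "a + b" a b] by (auto simp: vlt_def)

lemma veq_add_dominant: "vlt b a \<Longrightarrow> veq (a + b) a"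
  using vle_add_dominant[of b a] vle_add[of a a b] vlt_imp_vle[of b a] by (simp add: veq_def)

lemma vle_of_nat [simp]: "vle (of_nat n) 1"
  by (induction n) (auto intro: vle_add)

lemma of_nat_mem: "of_nat n \<in> V"
  using vle_of_nat[of n] by (simp only: vle_1_iff)

lemma veq_unit_mult: "veq u 1 \<Longrightarrow> veq (u * x) x"
  using veq_mult[of u 1 x x] by simp

lemma power_mem: "x \<in> V \<Longrightarrow> x ^ n \<in> V"
  by (induction n) (auto intro: mult_mem one_mem)

lemma sum_mem: "(\<And>i. i \<in> I \<Longrightarrow> g i \<in> V) \<Longrightarrow> sum g I \<in> V"
  using vle_sum[of I g 1] by (simp add: vle_1_iff)

lemma prod_mem: "(\<And>i. i \<in> I \<Longrightarrow> g i \<in> V) \<Longrightarrow> prod g I \<in> V"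
  by (induction I rule: infinite_finite_induct) (auto intro: mult_mem one_mem)

text \<open>The root bound over the residue field, without constructing that field: the elements of
  \<open>R\<close> are pairwise incongruent modulo the maximal ideal and are roots of
  \<open>q\<close> modulo it. One of them is divided off at a time.\<close>

lemma card_incongruent_roots:
  assumes "\<And>i. coeff q i \<in> V" "veq (lead_coeff q) 1"
    and "finite R" "R \<subseteq> V" "\<And>x y. x \<in> R \<Longrightarrow> y \<in> R \<Longrightarrow> x \<noteq> y \<Longrightarrow> veq (x - y) 1"
    and "\<And>x. x \<in> R \<Longrightarrow> vlt (poly q x) 1"
  shows "card R \<le> degree q"
  using assms
proof (induction "degree q" arbitrary: q R)
  case 0
  then obtain c where "q = [:c:]" by (metis degree_eq_zeroE)
  hence "R = {}" using 0 by (auto simp: veq_def vlt_def)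
  thus ?case by simp
next
  case (Suc n)
  show ?case
  proof (cases "R = {}")
    case False
    then obtain a where a: "a \<in> R" by blast
    define g where "g = synthetic_div q a"
    have q: "q = [:- a, 1:] * g + [:poly q a:]"
      unfolding g_def by (simp only: synthetic_div_correct')
    have deg: "degree g = n" using Suc.hyps(2) by (simp add: g_def degree_synthetic_div)
    have "q + smult a g = pCons (poly q a) g"
      unfolding g_def by (rule synthetic_div_correct)
    hence rec: "coeff g i = coeff q (Suc i) + a * coeff g (Suc i)" for i
      by (metis coeff_add coeff_pCons_Suc coeff_smult)
    \<comment> \<open>The recursion \<open>rec\<close> yields the quotient's coefficients from the
      top down, so \<open>j\<close> counts the distance from the leading one.\<close>
    have memg: "coeff g (n - j) \<in> V" if "j \<le> n" for j
      using that
    proof (induction j)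
      case 0
      show ?case using rec[of n] deg Suc.prems(1) by (simp add: coeff_eq_0)
    next
      case (Suc j)
      have "coeff g (n - Suc j) = coeff q (n - j) + a * coeff g (n - j)"
        using rec[of "n - Suc j"] Suc.prems by (simp add: Suc_diff_Suc)
      thus ?case using Suc \<open>a \<in> R\<close> \<open>R \<subseteq> V\<close> \<open>\<And>i. coeff q i \<in> V\<close>
        by (auto intro!: add_mem mult_mem)
    qed
    have coeff_g: "coeff g i \<in> V" for i
      using memg[of "n - i"] deg by (cases "i \<le> n") (auto simp: coeff_eq_0 zero_mem)
    have lead: "veq (lead_coeff g) 1"
      using rec[of n] deg Suc.hyps(2) Suc.prems(2) by (simp add: coeff_eq_0)
    have small: "vlt (poly g x) 1" if "x \<in> R - {a}" for x
    proof -
      have "(x - a) * poly g x = poly q x - poly q a"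
        by (subst q) (simp add: algebra_simps)
      hence "vlt ((x - a) * poly g x) 1"
        using vlt_diff Suc.prems(6) that a by simp
      moreover have "vle 1 (x - a)" using Suc.prems(5)[of x a] that a by (auto simp: veq_def)
      hence "vle (1 * poly g x) ((x - a) * poly g x)" by (intro vle_mult) auto
      ultimately show ?thesis using vle_vlt_trans by simp
    qed
    have "card (R - {a}) \<le> degree g"
      using Suc.prems coeff_g lead small deg by (intro Suc.hyps(1)) auto
    thus ?thesis using a deg Suc.hyps(2) \<open>finite R\<close> by (simp add: card_Diff_singleton)
  qed auto
qed

end

section \<open>Existence of places\<close>

text \<open>Chevalley's extension theorem for the place \<open>x = \<infinity>\<close> of \<open>F(x)\<close>: a subring that is maximal
  among those containing \<open>1/x\<close> but not \<open>x\<close> is a valuation ring.\<close>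

locale maximal_avoiding =
  fixes S :: "'k::field set" and x :: 'k
  assumes one: "1 \<in> S"
    and diff: "a \<in> S \<Longrightarrow> b \<in> S \<Longrightarrow> a - b \<in> S"
    and mult: "a \<in> S \<Longrightarrow> b \<in> S \<Longrightarrow> a * b \<in> S"
    and inv_x: "inverse x \<in> S" and x: "x \<notin> S"
    and maximal: "\<And>T. S \<subseteq> T \<Longrightarrow> 1 \<in> T \<Longrightarrow> (\<And>a b. a \<in> T \<Longrightarrow> b \<in> T \<Longrightarrow> a - b \<in> T) \<Longrightarrow>
      (\<And>a b. a \<in> T \<Longrightarrow> b \<in> T \<Longrightarrow> a * b \<in> T) \<Longrightarrow> x \<notin> T \<Longrightarrow> T = S"
begin

lemma zero: "0 \<in> S" using diff[OF one one] by simp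

lemma uminus: "a \<in> S \<Longrightarrow> - a \<in> S" using diff[OF zero, of a] by simp

lemma add: "a \<in> S \<Longrightarrow> b \<in> S \<Longrightarrow> a + b \<in> S" using diff[of a "- b"] uminus[of b] by simp

lemma sum: "(\<And>i. i \<in> I \<Longrightarrow> g i \<in> S) \<Longrightarrow> sum g I \<in> S"
  by (induction I rule: infinite_finite_induct) (auto intro: add zero)

lemma x_nonzero: "x \<noteq> 0" using x zero by auto

lemma one_minus_nonzero:
  assumes "b \<in> S"
  shows "1 - inverse x * b \<noteq> 0"
proof
  assume "1 - inverse x * b = 0"
  hence "x = b" using x_nonzero by (simp add: field_simps)
  thus False using assms x by simp
qed

text \<open>Adjoining all fractions \<open>a / (1 - b / x)\<close> does not produce
  \<open>x\<close>, because \<open>x = c / (1 - d / x)\<close> means \<open>x = c + d\<close>. By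
  maximality these fractions already lie in \<open>S\<close>.\<close>

lemma inverse_one_minus:
  assumes b: "b \<in> S"
  shows "inverse (1 - inverse x * b) \<in> S"
proof -
  let ?t = "inverse x"
  define T where "T = {a / (1 - ?t * b) | a b. a \<in> S \<and> b \<in> S}"
  have TI: "a / (1 - ?t * b) \<in> T" if "a \<in> S" "b \<in> S" for a b
    unfolding T_def using that by blast
  have "T = S"
  proof (rule maximal)
    show "S \<subseteq> T" using TI[OF _ zero] by auto
    show "1 \<in> T" using TI[OF one zero] by simp
  next
    fix a b assume "a \<in> T" "b \<in> T"
    then obtain c d c' d' where *: "a = c / (1 - ?t * d)" "b = c' / (1 - ?t * d')"
      "c \<in> S" "d \<in> S" "c' \<in> S" "d' \<in> S" by (auto simp: T_def)
    define e where "e = d + d' - ?t * (d * d')"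
    have e: "(1 - ?t * d) * (1 - ?t * d') = 1 - ?t * e"
      by (simp add: e_def algebra_simps)
    have "e \<in> S" unfolding e_def using * by (intro diff add mult inv_x)
    have nz: "1 - ?t * d \<noteq> 0" "1 - ?t * d' \<noteq> 0" using one_minus_nonzero * by auto
    have "a - b = (c * (1 - ?t * d') - c' * (1 - ?t * d)) / (1 - ?t * e)"
      unfolding e[symmetric] * using nz by (simp add: diff_frac_eq)
    also have "\<dots> \<in> T" using * \<open>e \<in> S\<close> by (intro TI diff mult one inv_x)
    finally show "a - b \<in> T" .
    have "a * b = (c * c') / (1 - ?t * e)" unfolding e[symmetric] * by simp
    also have "\<dots> \<in> T" using * \<open>e \<in> S\<close> by (intro TI mult)
    finally show "a * b \<in> T" .
  next
    show "x \<notin> T"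
    proof
      assume "x \<in> T"
      then obtain c d where cd: "x = c / (1 - ?t * d)" "c \<in> S" "d \<in> S" by (auto simp: T_def)
      have "x - d = x * (1 - ?t * d)" using x_nonzero by (simp add: right_diff_distrib)
      also have "\<dots> = c" by (subst cd(1)) (use one_minus_nonzero[OF cd(3)] in simp)
      finally have "x = c + d" by (simp add: diff_eq_eq)
      thus False using cd add x by auto
    qed
  qed
  thus ?thesis using TI[OF one b] by (simp add: inverse_eq_divide)
qed

text \<open>Here \<open>n\<close> counts terms, so the degree in \<open>y\<close> is below
  \<open>n\<close>; the empty sum at \<open>n = 0\<close> would force \<open>x = 0\<close>.\<close>

definition rep :: "'k \<Rightarrow> nat \<Rightarrow> bool" where
  "rep y n \<longleftrightarrow> (\<exists>c. (\<forall>i. c i \<in> S) \<and> x = (\<Sum>i<n. c i * y ^ i))"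

text \<open>The ring \<open>S[y]\<close> is strictly larger than \<open>S\<close>, so maximality
  puts \<open>x\<close> into it.\<close>

lemma rep_adjoin:
  assumes "y \<notin> S"
  shows "\<exists>n. rep y n"
proof (rule ccontr)
  assume no: "\<nexists>n. rep y n"
  define T where "T = {poly q y | q. \<forall>i. coeff q i \<in> S}"
  have TI: "poly q y \<in> T" if "\<And>i. coeff q i \<in> S" for q unfolding T_def using that by blast
  have "T = S"
  proof (rule maximal)
    show "S \<subseteq> T"
    proof
      fix a assume "a \<in> S"
      thus "a \<in> T" using TI[of "[:a:]"] zero by (simp add: coeff_pCons split: nat.splits)
    qed
    show "1 \<in> T" using TI[of 1] one zero by (auto simp: coeff_1)
  next
    fix a b assume "a \<in> T" "b \<in> T"
    then obtain q r where qr: "a = poly q y" "b = poly r y" "\<And>i. coeff q i \<in> S" "\<And>i. coeff r i \<in> S"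
      by (auto simp: T_def)
    show "a - b \<in> T" using TI[of "q - r"] qr diff by simp
    have "coeff (q * r) i \<in> S" for i unfolding coeff_mult by (intro sum mult qr)
    thus "a * b \<in> T" using TI[of "q * r"] qr by simp
  next
    show "x \<notin> T"
    proof
      assume "x \<in> T"
      then obtain q where "x = poly q y" "\<forall>i. coeff q i \<in> S" by (auto simp: T_def)
      hence "rep y (Suc (degree q))"
        unfolding rep_def poly_altdef lessThan_Suc_atMost by blast
      thus False using no by blast
    qed
  qed
  moreover have "y \<in> T"
    using TI[of "[:0, 1:]"] zero one by (simp add: coeff_pCons split: nat.splits)
  ultimately show False using assms by simp
qed

text \<open>Multiplying the representation in \<open>inverse y\<close> by \<open>y ^ n / x\<close>
  and isolating its constant term gives \<open>y ^ n * (1 - r 0 / x)\<close> as a combination of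
  lower powers of \<open>y\<close>. The factor \<open>1 - r 0 / x\<close> is a unit of
  \<open>S\<close>, so the top term \<open>y ^ n\<close> can be eliminated.\<close>

lemma rep_descend:
  assumes "y \<noteq> 0" "rep y (Suc n)" "rep (inverse y) (Suc m)" "m \<le> n"
  shows "rep y n"
proof -
  let ?t = "inverse x"
  obtain c where c: "\<And>i. c i \<in> S" "x = (\<Sum>i<Suc n. c i * y ^ i)" using assms(2) by (auto simp: rep_def)
  obtain r where r: "\<And>i. r i \<in> S" "x = (\<Sum>i<Suc m. r i * inverse y ^ i)"
    using assms(3) by (auto simp: rep_def)
  define v where "v = inverse (1 - ?t * r 0)"
  have v: "v \<in> S" "v * (1 - ?t * r 0) = 1"
    using inverse_one_minus[OF r(1)] one_minus_nonzero[OF r(1)] by (auto simp: v_def)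
  \<comment> \<open>The coefficients \<open>r\<close> in reversed order, padded with zeros.\<close>
  define g where "g i = (if n - i \<le> m then r (n - i) else 0)" for i
  have g: "g i \<in> S" for i using r zero by (auto simp: g_def)
  have "x = r 0 + (\<Sum>i=1..m. r i * inverse y ^ i)"
    using r(2) sum.lessThan_Suc_shift[of "\<lambda>i. r i * inverse y ^ i" m]
    by (simp add: sum.atLeast1_atMost_eq del: sum.lessThan_Suc)
  hence "y ^ n * (x - r 0) = (\<Sum>i=1..m. r i * (y ^ n * inverse y ^ i))"
    by (simp add: sum_distrib_left mult_ac)
  also have "\<dots> = (\<Sum>i=1..m. r i * y ^ (n - i))"
    using assms by (intro sum.cong refl) (auto simp: power_diff power_inverse field_simps)
  also have "\<dots> = (\<Sum>i=n-m..<n. r (n - i) * y ^ i)"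
    by (rule sum.reindex_bij_witness[of _ "\<lambda>i. n - i" "\<lambda>i. n - i"]) (use assms in auto)
  also have "\<dots> = (\<Sum>i<n. g i * y ^ i)"
    by (rule sum.mono_neutral_cong_left) (auto simp: g_def)
  finally have *: "y ^ n * (x - r 0) = (\<Sum>i<n. g i * y ^ i)" .
  have "y ^ n = y ^ n * (v * (1 - ?t * r 0))" using v by simp
  also have "1 - ?t * r 0 = ?t * (x - r 0)" using x_nonzero by (simp add: algebra_simps)
  also have "y ^ n * (v * (?t * (x - r 0))) = v * ?t * (\<Sum>i<n. g i * y ^ i)"
    unfolding *[symmetric] by (simp add: mult_ac)
  finally have yn: "y ^ n = v * ?t * (\<Sum>i<n. g i * y ^ i)" .
  have "x = (\<Sum>i<n. c i * y ^ i) + c n * (v * ?t * (\<Sum>i<n. g i * y ^ i))"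
    using c(2) yn by simp
  also have "\<dots> = (\<Sum>i<n. (c i + c n * (v * ?t * g i)) * y ^ i)"
    unfolding distrib_right sum.distrib by (simp add: sum_distrib_left mult_ac)
  finally show ?thesis unfolding rep_def
    using c(1) g v(1) inv_x by (intro exI[of _ "\<lambda>i. c i + c n * (v * ?t * g i)"]) (auto intro!: add mult)
qed

text \<open>If neither \<open>y\<close> nor \<open>inverse y\<close> lay in \<open>S\<close>, both
  would have shortest representations of \<open>x\<close>, and the longer of the two could be
  shortened by \<open>rep_descend\<close>.\<close>

lemma valuation_ring: "valuation_ring S"
proof (unfold_locales)
  fix y
  show "inverse y \<in> S" if "y \<notin> S"
  proof (rule ccontr)
    assume iy: "inverse y \<notin> S"
    have "y \<noteq> 0" using that zero by auto
    define n where "n = (LEAST n. rep y n)"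
    define m where "m = (LEAST n. rep (inverse y) n)"
    have n: "rep y n" "\<And>k. rep y k \<Longrightarrow> n \<le> k"
      using rep_adjoin[OF that] unfolding n_def by (metis LeastI_ex, metis Least_le)
    have m: "rep (inverse y) m" "\<And>k. rep (inverse y) k \<Longrightarrow> m \<le> k"
      using rep_adjoin[OF iy] unfolding m_def by (metis LeastI_ex, metis Least_le)
    have nz: "\<not> rep z 0" for z using x_nonzero by (simp add: rep_def)
    obtain n' m' where nm: "n = Suc n'" "m = Suc m'"
      using n(1) m(1) nz by (metis not0_implies_Suc)
    show False
    proof (cases "m' \<le> n'")
      case True
      hence "rep y n'" using rep_descend[OF \<open>y \<noteq> 0\<close>] n m nm by blast
      thus False using n(2) nm by force
    next
      case False
      hence "rep (inverse y) m'"
        using rep_descend[of "inverse y" m' n'] n m nm \<open>y \<noteq> 0\<close> by simp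
      thus False using m(2) nm by force
    qed
  qed
qed (auto intro: one diff mult)

end

lemma exists_valuation_ring_avoiding:
  fixes F :: "'k::field set"
  assumes F: "1 \<in> F" "\<And>a b. a \<in> F \<Longrightarrow> b \<in> F \<Longrightarrow> a - b \<in> F" "\<And>a b. a \<in> F \<Longrightarrow> b \<in> F \<Longrightarrow> a * b \<in> F"
    and transcendental: "\<And>h. h \<noteq> 0 \<Longrightarrow> (\<And>i. coeff h i \<in> F) \<Longrightarrow> poly h x \<noteq> 0"
  shows "\<exists>V. valuation_ring V \<and> F \<subseteq> V \<and> x \<notin> V"
proof -
  have F0: "0 \<in> F" using F(2)[OF F(1) F(1)] by simp
  have Fm: "- a \<in> F" if "a \<in> F" for a using F(2)[OF F0 that] by simp
  have Fa: "a + b \<in> F" if "a \<in> F" "b \<in> F" for a b using F(2)[OF that(1) Fm[OF that(2)]] by simp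
  have Fs: "sum g I \<in> F" if "\<And>i. i \<in> I \<Longrightarrow> g i \<in> F" for g and I :: "nat set"
    using that by (induction I rule: infinite_finite_induct) (auto intro: Fa F0)
  define ring where "ring T \<longleftrightarrow> 1 \<in> T \<and> (\<forall>a\<in>T. \<forall>b\<in>T. a - b \<in> T \<and> a * b \<in> T)" for T :: "'k set"
  define \<A> where "\<A> = {T. ring T \<and> F \<subseteq> T \<and> inverse x \<in> T \<and> x \<notin> T}"
  \<comment> \<open>The ring \<open>F[1/x]\<close> is the starting point for Zorn's lemma.\<close>
  define T0 where "T0 = {poly q (inverse x) | q. \<forall>i. coeff q i \<in> F}"
  have TI: "poly q (inverse x) \<in> T0" if "\<And>i. coeff q i \<in> F" for q unfolding T0_def using that by blast
  have "x \<noteq> 0" using transcendental[of "[:0, 1:]"] F0 F(1) by (auto simp: coeff_pCons split: nat.splits)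
  have "T0 \<in> \<A>"
  proof -
    have "ring T0" unfolding ring_def
    proof (intro conjI ballI)
      show "1 \<in> T0" using TI[of 1] F(1) F0 by (auto simp: coeff_1)
      fix a b assume "a \<in> T0" "b \<in> T0"
      then obtain q r where qr: "a = poly q (inverse x)" "b = poly r (inverse x)"
        "\<And>i. coeff q i \<in> F" "\<And>i. coeff r i \<in> F" by (auto simp: T0_def)
      show "a - b \<in> T0" using TI[of "q - r"] qr F(2) by simp
      have "coeff (q * r) i \<in> F" for i unfolding coeff_mult by (intro Fs F(3) qr)
      thus "a * b \<in> T0" using TI[of "q * r"] qr by simp
    qed
    moreover have "F \<subseteq> T0"
    proof
      fix a assume "a \<in> F"
      thus "a \<in> T0" using TI[of "[:a:]"] F0 by (simp add: coeff_pCons split: nat.splits)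
    qed
    moreover have "inverse x \<in> T0"
      using TI[of "[:0, 1:]"] F0 F(1) by (simp add: coeff_pCons split: nat.splits)
    moreover have "x \<notin> T0"
    proof
      assume "x \<in> T0"
      then obtain q where q: "x = poly q (inverse x)" "\<And>i. coeff q i \<in> F" by (auto simp: T0_def)
      let ?n = "degree q"
      \<comment> \<open>Clearing denominators in \<open>x = q(1/x)\<close> gives this monic equation
        for \<open>x\<close> over \<open>F\<close>.\<close>
      define h where "h = monom 1 (Suc ?n) - (\<Sum>i\<le>?n. monom (coeff q i) (?n - i))"
      have "coeff h (Suc ?n) = 1" 
        unfolding h_def by (simp add: coeff_sum) (intro sum.neutral, auto)
      hence "h \<noteq> 0" by auto
      moreover have "coeff h i \<in> F" for i
        unfolding h_def coeff_diff coeff_sum using F(1) F0 q(2) by (intro F(2) Fs) auto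
      moreover have "poly h x = 0"
      proof -
        have "x ^ ?n * x = x ^ ?n * poly q (inverse x)" using q(1) by simp
        also have "\<dots> = (\<Sum>i\<le>?n. coeff q i * x ^ (?n - i))"
          unfolding poly_altdef sum_distrib_left using \<open>x \<noteq> 0\<close>
          by (intro sum.cong refl) (auto simp: power_diff power_inverse field_simps)
        finally show ?thesis by (simp add: h_def poly_monom poly_sum mult.commute)
      qed
      ultimately show False using transcendental by blast
    qed
    ultimately show ?thesis by (simp add: \<A>_def)
  qed
  have "\<exists>S\<in>\<A>. \<forall>X\<in>\<A>. S \<subseteq> X \<longrightarrow> X = S"
  proof (rule subset_Zorn_nonempty)
    show "\<A> \<noteq> {}" using \<open>T0 \<in> \<A>\<close> by blast
  next
    fix \<C> assume C: "\<C> \<noteq> {}" "subset.chain \<A> \<C>"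
    have sub: "\<C> \<subseteq> \<A>" using C(2) by (auto simp: subset.chain_def)
    have join: "\<exists>T\<in>\<C>. a \<in> T \<and> b \<in> T" if "a \<in> \<Union>\<C>" "b \<in> \<Union>\<C>" for a b
      using that C(2) unfolding subset_chain_def by blast
    have "ring (\<Union>\<C>)" unfolding ring_def
    proof (intro conjI ballI)
      show "1 \<in> \<Union>\<C>" using C(1) sub by (auto simp: \<A>_def ring_def)
      fix a b assume "a \<in> \<Union>\<C>" "b \<in> \<Union>\<C>"
      then obtain T where T: "T \<in> \<C>" "a \<in> T" "b \<in> T" using join by blast
      hence "ring T" using sub by (auto simp: \<A>_def)
      thus "a - b \<in> \<Union>\<C>" "a * b \<in> \<Union>\<C>" using T by (auto simp: ring_def)
    qed
    thus "\<Union>\<C> \<in> \<A>" using C(1) sub by (auto simp: \<A>_def)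
  qed
  then obtain S where S: "S \<in> \<A>" "\<And>X. X \<in> \<A> \<Longrightarrow> S \<subseteq> X \<Longrightarrow> X = S" by blast
  interpret maximal_avoiding S x
  proof
    show "1 \<in> S" "inverse x \<in> S" "x \<notin> S" using S(1) by (auto simp: \<A>_def ring_def)
    show "a - b \<in> S" "a * b \<in> S" if "a \<in> S" "b \<in> S" for a b
      using S(1) that by (auto simp: \<A>_def ring_def)
    show "T = S" if "S \<subseteq> T" "1 \<in> T" "\<And>a b. a \<in> T \<Longrightarrow> b \<in> T \<Longrightarrow> a - b \<in> T"
      "\<And>a b. a \<in> T \<Longrightarrow> b \<in> T \<Longrightarrow> a * b \<in> T" "x \<notin> T" for T
      using S(1) that by (intro S(2)) (auto simp: \<A>_def ring_def)
  qed
  show ?thesis using valuation_ring S(1) by (auto simp: \<A>_def)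
qed

section \<open>Orbits at a place\<close>

context valuation_ring
begin

lemma vlt_sum: "c \<noteq> 0 \<Longrightarrow> (\<And>i. i \<in> I \<Longrightarrow> vlt (g i) c) \<Longrightarrow> vlt (sum g I) c"
  by (induction I rule: infinite_finite_induct) (auto intro: vlt_add)

lemma veq_vlt_trans: "veq x y \<Longrightarrow> vlt y z \<Longrightarrow> vlt x z"
  using veqD(1) vle_vlt_trans by blast

lemma vlt_veq_trans: "vlt x y \<Longrightarrow> veq y z \<Longrightarrow> vlt x z"
  using veqD(1) vlt_vle_trans by blast

text \<open>By Fermat the image of \<open>n\<close> is a root of unity of order dividing
  \<open>p - 1\<close>, hence has absolute value 1.\<close>

lemma unit_of_nat:
  assumes "prime p" "CHAR('k) = p" "\<not> p dvd n"
  shows "veq (of_nat n) 1"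
proof -
  let ?x = "of_nat n :: 'k"
  have "?x ^ p = ?x" by (rule Ints_power_char[OF assms(1,2)]) simp
  moreover have "?x \<noteq> 0" using assms by (simp add: of_nat_eq_0_iff_char_dvd)
  moreover have "?x ^ p = ?x * ?x ^ (p - 1)"
    using prime_gt_0_nat[OF assms(1)] by (cases p) auto
  ultimately have "?x ^ (p - 1) = 1 ^ (p - 1)" by simp
  thus ?thesis using veq_power_iff[of "p - 1" ?x 1] prime_gt_1_nat[OF assms(1)] by simp
qed

text \<open>Each further factor \<open>y\<close> in place of \<open>b\<close> shrinks a term, and
  binomial coefficients are integral; so all terms of order at least 2 are smaller than
  \<open>b ^ (n - 1) * y\<close>.\<close>

lemma binomial_first_order:
  assumes "vlt y b" "y \<noteq> 0" "n > 0"
  shows "vlt ((b + y) ^ n - b ^ n - of_nat n * b ^ (n - 1) * y) (b ^ (n - 1) * y)"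
proof -
  define T where "T j = of_nat (n choose j) * y ^ j * b ^ (n - j)" for j
  have "b \<noteq> 0" using assms vlt_imp_nonzero by blast
  have "(b + y) ^ n = (\<Sum>j\<le>n. T j)"
    unfolding T_def using binomial_ring[of y b n] by (simp add: add.commute)
  also have "{..n} = insert 0 (insert 1 {2..n})" using assms by auto
  finally have "(b + y) ^ n - b ^ n - of_nat n * b ^ (n - 1) * y = (\<Sum>j=2..n. T j)"
    by (simp add: T_def mult_ac)
  moreover have "vlt (T j) (b ^ (n - 1) * y)" if j: "j \<in> {2..n}" for j
  proof -
    have "vle (T j) (1 * y ^ j * b ^ (n - j))" unfolding T_def by (intro vle_mult) auto
    also have "1 * y ^ j * b ^ (n - j) = y ^ (j - 1) * (y * b ^ (n - j))"
      using j by (simp add: power_eq_if)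
    also have "vlt \<dots> (b ^ (j - 1) * (y * b ^ (n - j)))"
      using j assms \<open>b \<noteq> 0\<close> by (intro vlt_vle_mult vlt_power) auto
    also have "b ^ (j - 1) * (y * b ^ (n - j)) = b ^ (j - 1 + (n - j)) * y"
      by (simp add: power_add)
    also have "j - 1 + (n - j) = n - 1" using j by auto
    finally show ?thesis .
  qed
  moreover have "b ^ (n - 1) * y \<noteq> 0" using \<open>b \<noteq> 0\<close> assms by simp
  ultimately show ?thesis using vlt_sum[of "b ^ (n - 1) * y" "{2..n}" T] by presburger
qed

lemma finite_max_exists:
  assumes "finite A" "A \<noteq> {}"
  shows "\<exists>M\<in>A. \<forall>x\<in>A. vle x M"
  using assms
proof (induction A rule: finite_ne_induct)
  case (insert x A)
  then obtain M where M: "M \<in> A" "\<forall>x\<in>A. vle x M" by blast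
  show ?case
  proof (cases "vle x M")
    case False
    hence "vle M x" using vle_total by blast
    thus ?thesis using M vle_trans by (intro bexI[of _ x]) auto
  qed (use M in auto)
qed auto

end

locale binomial_place = valuation_ring V for V :: "'k::field set" +
  fixes p le k s :: nat and z u :: 'k
  assumes prime: "prime p" and char: "CHAR('k) = p"
    and unit_z: "veq z 1" and unit_u: "veq u 1"
    and s_ge_3: "3 \<le> s" and s_less: "s < p ^ k" and s_ndvd: "\<not> p dvd s"
begin

definition Q :: nat where "Q = p ^ k"

definition e :: nat where "e = p ^ le"

definition g :: "'k \<Rightarrow> 'k" where "g x = z * x ^ Q + u * x ^ s"

definition f :: "'k \<Rightarrow> 'k" where "f x = g x ^ e"

definition orb :: "'k \<Rightarrow> nat \<Rightarrow> 'k \<Rightarrow> 'k" where "orb t n x = ((\<lambda>x. f x + t) ^^ n) x"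

lemma orb_0 [simp]: "orb t 0 x = x" by (simp add: orb_def)

lemma orb_Suc: "orb t (Suc n) x = f (orb t n x) + t" by (simp add: orb_def)

lemma e_pos: "e > 0" using prime by (simp add: e_def prime_gt_0_nat)

lemma s_less_Q: "s < Q" using s_less by (simp add: Q_def)

lemma unit_s: "veq (of_nat s) 1" by (rule unit_of_nat[OF prime char s_ndvd])

lemma g_diff: "g x - g y = z * (x - y) ^ Q + u * (x ^ s - y ^ s)"
  unfolding g_def Q_def frobenius_diff[OF prime char] by (simp add: algebra_simps)

lemma f_diff: "f x - f y = (g x - g y) ^ e"
  unfolding f_def e_def frobenius_diff[OF prime char] ..

lemma unit_mult_vle: "veq c 1 \<Longrightarrow> vle (c * x) y \<longleftrightarrow> vle x y"
  using veq_unit_mult[of c x] veqD vle_trans by blast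

lemma unit_mult_vlt: "veq c 1 \<Longrightarrow> vlt (c * x) y \<longleftrightarrow> vlt x y"
  using veq_unit_mult[of c x] veqD vle_vlt_trans by blast

lemma f_big:
  assumes "vlt 1 x"
  shows "veq (f x) (x ^ (Q * e))"
proof -
  have "vlt (x ^ s) (x ^ Q)" by (rule power_vlt_power[OF assms s_less_Q])
  hence "vlt (u * x ^ s) (z * x ^ Q)"
    using veq_unit_mult[OF unit_u] veq_unit_mult[OF unit_z, THEN veq_sym] veq_vlt_trans vlt_veq_trans
    by blast
  hence "veq (g x) (z * x ^ Q)" unfolding g_def by (rule veq_add_dominant)
  also have "veq \<dots> (x ^ Q)" by (rule veq_unit_mult[OF unit_z])
  finally show ?thesis unfolding f_def power_mult by (rule veq_power)
qed

lemma f_small: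
  assumes "x \<in> V"
  shows "f x \<in> V"
  using assms unit_z unit_u unfolding f_def g_def
  by (intro power_mem add_mem mult_mem) (auto simp: veq_def vle_1_iff)

text \<open>Take an orbit point \<open>M\<close> of maximal size. If it is integral, so is
  \<open>t = orb t 1 x - f x\<close>. Otherwise |f M| = |M|^d exceeds every orbit point and must be
  cancelled by \<open>t\<close>. Then |t| exceeds every orbit point as well, so |f y| = |t| for each
  of them, which fixes |y|.\<close>

lemma preperiodic_cases:
  assumes "preperiodic (\<lambda>x. f x + t) x"
  shows "(x \<in> V \<and> t \<in> V) \<or> (vlt 1 x \<and> veq t (x ^ (Q * e)) \<and> (\<forall>n. veq (orb t n x) x))"
proof -
  define d where "d = Q * e"
  have "Q * 1 \<le> Q * e" using e_pos by (intro mult_le_mono) auto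
  hence d: "d > 1" using s_less_Q s_ge_3 unfolding d_def by linarith
  have "finite (range (\<lambda>n. orb t n x))" using assms by (simp add: preperiodic_def orb_def)
  then obtain N where N: "\<And>n. vle (orb t n x) (orb t N x)"
    using finite_max_exists[of "range (\<lambda>n. orb t n x)"] by blast
  define M where "M = orb t N x"
  show ?thesis
  proof (cases "vle M 1")
    case True
    hence "vle (orb t n x) 1" for n using N vle_trans unfolding M_def by blast
    hence orb: "orb t n x \<in> V" for n by (simp add: vle_1_iff)
    have "t = orb t 1 x - f x" by (simp add: orb_Suc)
    also have "\<dots> \<in> V" using orb[of 1] orb[of 0] f_small by (intro diff_mem) auto
    finally show ?thesis using orb[of 0] by simp
  next
    case False
    hence M: "vlt 1 M" by (simp add: not_vle)
    have Md: "vlt M (M ^ d)" using power_vlt_power[OF M d] by simp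
    have fM: "veq (f M) (M ^ d)" unfolding d_def by (rule f_big[OF M])
    have "vle (orb t (Suc N) x) M" using N unfolding M_def .
    hence "vlt (orb t (Suc N) x) (f M)"
      using Md fM vle_vlt_trans vlt_veq_trans veq_sym by blast
    hence "vlt (- orb t (Suc N) x) (f M)"
      by (simp add: vle_vlt_trans[of "- orb t (Suc N) x" "orb t (Suc N) x"])
    hence "veq (f M + - orb t (Suc N) x) (f M)" by (rule veq_add_dominant)
    moreover have "f M + - orb t (Suc N) x = - t" by (simp add: orb_Suc M_def)
    ultimately have "veq (- t) (f M)" by simp
    hence tM: "veq t (M ^ d)"
      using fM veq_trans[of t "f M" "M ^ d"] vle_uminus[of t "f M"] vle_uminus[of "- t" t]
        vle_trans[of "f M" "- t" t] by (auto simp: veq_def)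
    have Mt: "vlt M t" using Md tM vlt_veq_trans veq_sym by blast
    have size: "vlt 1 (orb t n x) \<and> veq (orb t n x ^ d) t" for n
    proof -
      let ?y = "orb t n x"
      have "vlt (orb t (Suc n) x) t" using N Mt vle_vlt_trans unfolding M_def by blast
      hence "veq (- t + orb t (Suc n) x) (- t)"
        using vlt_vle_trans[of "orb t (Suc n) x" t "- t"] vle_uminus[of "- t" "- t"]
        by (intro veq_add_dominant) auto
      moreover have "- t + orb t (Suc n) x = f ?y" by (simp add: orb_Suc)
      ultimately have "veq (f ?y) (- t)" by simp
      hence ft: "veq (f ?y) t"
        using vle_uminus[of t t] vle_uminus[of "- t" "f ?y"] vle_trans[of "f ?y" "- t" t]
        by (auto simp: veq_def)
      have "vlt 1 ?y"
      proof (rule ccontr)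
        assume "\<not> vlt 1 ?y"
        hence "vle (f ?y) 1" using f_small by (simp add: vle_1_iff not_vlt)
        hence "vle t 1" using ft veqD(2) vle_trans by blast
        thus False using M Mt vlt_trans vlt_def by blast
      qed
      thus ?thesis using f_big[of ?y] ft veq_trans veq_sym unfolding d_def by blast
    qed
    have x: "vlt 1 x" "veq (x ^ d) t" using size[of 0] by auto
    have "veq (orb t n x) x" for n
      using size[of n] x veq_trans[OF _ veq_sym[OF x(2)]] veq_power_iff[of d "orb t n x" x] d by auto
    thus ?thesis using x veq_sym unfolding d_def by blast
  qed
qed

end

section \<open>Distances between orbit points at a pole\<close>

locale binomial_pole = binomial_place V p le k s z u
  for V :: "'k::field set" and p le k s z u +
  fixes a w :: 'k
  assumes pole: "vlt 1 a" and w: "w ^ (p ^ k - 1) = a ^ (s - 1)"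
begin

text \<open>This makes \<open>w\<close> the critical distance: for |d| = |w| the terms
  \<open>z * d ^ Q\<close> and \<open>u * s * a ^ (s - 1) * d\<close> of a difference of
  \<open>g\<close>-values have equal size.\<close>

lemma w_power: "w ^ (Q - 1) = a ^ (s - 1)" using w by (simp add: Q_def)

lemma w_gt_1: "vlt 1 w"
proof -
  have "vlt (1 ^ (s - 1)) (a ^ (s - 1))" using pole s_ge_3 by (intro vlt_power) auto
  hence "vlt (1 ^ (Q - 1)) (w ^ (Q - 1))" unfolding w_power by simp
  thus ?thesis using vlt_power_iff[of "Q - 1" 1 w] s_less_Q s_ge_3 by simp
qed

lemma w_less_a: "vlt w a"
proof -
  have "vlt (a ^ (s - 1)) (a ^ (Q - 1))" using pole s_less_Q s_ge_3 by (intro power_vlt_power) auto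
  hence "vlt (w ^ (Q - 1)) (a ^ (Q - 1))" unfolding w_power .
  thus ?thesis using vlt_power_iff[of "Q - 1" w a] s_less_Q s_ge_3 by simp
qed

lemma nonzero: "a \<noteq> 0" "w \<noteq> 0" using pole w_gt_1 vlt_imp_nonzero by blast+

lemma w_Q: "w ^ Q = a ^ (s - 1) * w"
  using w_power s_less_Q by (cases Q) auto

text \<open>Strips the outer Frobenius: bounds on \<open>f x - f y = (g x - g y) ^ e\<close> pass to
  \<open>g x - g y\<close>.\<close>

lemma vle_of_power_e: "vle (x ^ e) y \<Longrightarrow> vle 1 y \<Longrightarrow> vle x y"
  using vle_power_self[OF _ e_pos, of y] vle_power_iff[OF e_pos, of x y] vle_trans[of "x ^ e" y "y ^ e"]
  by blast

text \<open>With \<open>d = x - y\<close>, the difference of \<open>g\<close>-values is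
  \<open>z * d ^ Q\<close> plus a term of size |w|^(Q-1) |d|. If |d| > |w|, the first dominates and
  exceeds |a|^(s-1), hence |a|, a contradiction; if |d| < |w|, the second dominates. Only at |d| =
  |w| can they cancel.\<close>

lemma pair_distance:
  assumes x: "veq x a" and y: "veq y a" and diff: "vle (g x - g y) a"
  shows "veq (x - y) w \<or> vlt (x - y) w \<and> vle ((x - y) * w ^ (Q - 1)) (g x - g y)"
proof (cases "x = y")
  case True
  thus ?thesis using nonzero by simp
next
  case False
  define d where "d = x - y"
  define E where "E = x ^ s - y ^ s"
  have d: "d \<noteq> 0" using False by (simp add: d_def)
  have gd: "g x - g y = z * d ^ Q + u * E" by (simp add: g_diff d_def E_def)
  have "vle (x ^ s) (a ^ s)" "vle (y ^ s) (a ^ s)" using x y by (auto intro: vle_power veqD)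
  hence E: "vle E (a ^ s)" unfolding E_def by (rule vle_diff)
  have "vle a (a ^ s)" using pole s_ge_3 by (intro vle_power_self vlt_imp_vle) auto
  hence "vle ((g x - g y) - u * E) (a ^ s)"
    using vle_trans[OF diff] E unit_mult_vle[OF unit_u, of E] vle_diff[of "g x - g y"] by auto
  hence dQ: "vle (d ^ Q) (a ^ s)" using gd unit_mult_vle[OF unit_z] by simp
  have "vlt (a ^ s) (a ^ Q)" by (rule power_vlt_power[OF pole s_less_Q])
  \<comment> \<open>This crude bound is what permits the first-order expansion of
    \<open>(y + d) ^ s\<close>.\<close>
  hence da: "vlt d a" using vle_vlt_trans[OF dQ] vlt_power_iff[of Q d a] s_less_Q by auto
  hence dy: "vlt d y" using y vlt_veq_trans veq_sym by blast
  have "vlt ((y + d) ^ s - y ^ s - of_nat s * y ^ (s - 1) * d) (y ^ (s - 1) * d)"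
    using s_ge_3 by (intro binomial_first_order[OF dy d]) auto
  hence "vlt (E - of_nat s * (y ^ (s - 1) * d)) (of_nat s * (y ^ (s - 1) * d))"
    using vlt_veq_trans[OF _ veq_sym[OF veq_unit_mult[OF unit_s]]]
    by (simp add: E_def d_def mult.assoc)
  from veq_add_dominant[OF this] have "veq E (of_nat s * (y ^ (s - 1) * d))" by simp
  also have "veq \<dots> (y ^ (s - 1) * d)" by (rule veq_unit_mult[OF unit_s])
  also have "veq \<dots> (a ^ (s - 1) * d)" by (intro veq_mult veq_power y veq_refl)
  finally have E': "veq E (w ^ (Q - 1) * d)" unfolding w_power .
  have uE: "veq (u * E) (w ^ (Q - 1) * d)" using veq_unit_mult[OF unit_u] E' veq_trans by blast
  have zd: "veq (z * d ^ Q) (d ^ (Q - 1) * d)"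
    using veq_unit_mult[OF unit_z, of "d ^ Q"] s_less_Q by (cases Q) (auto simp: mult.commute)
  have Q1: "Q - 1 > 0" using s_less_Q s_ge_3 by simp
  consider "vlt w d" | "veq d w" | "vlt d w" using vle_total[of w d] by (auto simp: vlt_def veq_def)
  thus ?thesis
  proof cases
    case 1
    have "vlt (w ^ (Q - 1)) (d ^ (Q - 1))" by (rule vlt_power[OF 1 Q1])
    hence "vlt (w ^ (Q - 1) * d) (d ^ (Q - 1) * d)" using d by (simp add: vlt_mult_cancel_right)
    hence "vlt (u * E) (z * d ^ Q)"
      using uE zd veq_vlt_trans vlt_veq_trans veq_sym by blast
    hence "vle (z * d ^ Q) a" using vle_trans[OF _ diff] vle_add_dominant unfolding gd by blast
    hence "vle (d ^ Q) a" using unit_mult_vle[OF unit_z] by blast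
    moreover have "vle a (a ^ (s - 1))" using pole s_ge_3 by (intro vle_power_self vlt_imp_vle) auto
    hence "vlt a (d ^ (Q - 1))"
      using \<open>vlt (w ^ (Q - 1)) (d ^ (Q - 1))\<close> vle_vlt_trans unfolding w_power by blast
    moreover have "vle (d ^ (Q - 1)) (d ^ Q)"
      using 1 w_gt_1 vlt_trans vlt_imp_vle by (intro power_vle_power) (blast, simp)
    ultimately have False using vlt_vle_trans vlt_irrefl by blast
    thus ?thesis ..
  next
    case 2
    thus ?thesis by (simp add: d_def)
  next
    case 3
    have "vlt (d ^ (Q - 1)) (w ^ (Q - 1))" by (rule vlt_power[OF 3 Q1])
    hence "vlt (d ^ (Q - 1) * d) (w ^ (Q - 1) * d)" using d by (simp add: vlt_mult_cancel_right)
    hence "vlt (z * d ^ Q) (u * E)"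
      using uE zd veq_vlt_trans vlt_veq_trans veq_sym by blast
    hence "vle (u * E) (g x - g y)" using vle_add_dominant[of "z * d ^ Q" "u * E"] unfolding gd by (simp add: add.commute)
    hence "vle (w ^ (Q - 1) * d) (g x - g y)" using uE veqD vle_trans by blast
    thus ?thesis using 3 by (simp add: d_def mult.commute)
  qed
qed

lemma pair_distance_le:
  assumes "veq x a" "veq y a" "vle (f x - f y) a"
  shows "vle (x - y) w"
  using pair_distance[OF assms(1,2)] assms(3) vle_of_power_e[of "g x - g y" a] pole veqD vlt_imp_vle
  unfolding f_diff by blast

text \<open>The sharper bound \<open>w\<close> on the difference of values cancels one factor
  \<open>w\<close>, whence the exponent \<open>Q - 2\<close>.\<close>

lemma pair_distance_cases:
  assumes "veq x a" "veq y a" "vle (f x - f y) w"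
  shows "veq (x - y) w \<or> vlt (x - y) w \<and> vle ((x - y) * w ^ (Q - 2)) 1"
proof -
  have gw: "vle (g x - g y) w"
    using assms(3) vle_of_power_e w_gt_1 vlt_imp_vle unfolding f_diff by blast
  hence "vle (g x - g y) a" using w_less_a vlt_imp_vle vle_trans by blast
  from pair_distance[OF assms(1,2) this] show ?thesis
  proof
    assume *: "vlt (x - y) w \<and> vle ((x - y) * w ^ (Q - 1)) (g x - g y)"
    hence "vle ((x - y) * w ^ (Q - 1)) w" using gw vle_trans by blast
    moreover have "Q - 1 = Suc (Q - 2)" using s_less_Q s_ge_3 by simp
    ultimately have "vle ((x - y) * w ^ (Q - 2) * w) (1 * w)" by (simp add: mult_ac)
    thus ?thesis using * vle_mult_cancel_right nonzero by blast
  qed auto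
qed

definition bounded_at :: "'k \<Rightarrow> 'k \<Rightarrow> bool" where
  "bounded_at t x \<longleftrightarrow> (\<forall>n. veq (orb t n x) a)"

lemma bounded_atD: "bounded_at t x \<Longrightarrow> veq (orb t n x) a" by (simp add: bounded_at_def)

text \<open>The parameter cancels between successors. The indices may differ, so
  \<open>orb t 1 a\<close> can be compared with \<open>a\<close> itself.\<close>

lemma orbit_pair_le:
  assumes "bounded_at t x" "bounded_at t y"
  shows "vle (orb t n x - orb t m y) w"
proof -
  have "vle (orb t (Suc n) x - orb t (Suc m) y) a"
    using assms by (intro vle_diff) (auto intro: veqD bounded_atD)
  hence "vle (f (orb t n x) - f (orb t m y)) a" by (simp add: orb_Suc)
  thus ?thesis using assms by (intro pair_distance_le bounded_atD)
qed

text \<open>Both orbits start at \<open>a\<close>, so \<open>t - t'\<close> is the difference of the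
  first iterates. The bound |a| on differences of iterates improves to |w| by one application of
  \<open>pair_distance_le\<close>; with |w| available, \<open>pair_distance_cases\<close> applies to
  the first iterates.\<close>

lemma parameter_distance:
  assumes "bounded_at t a" "bounded_at t' a"
  shows "veq (t - t') w \<or> vlt (t - t') w \<and> vle ((t - t') * w ^ (Q - 2)) 1"
proof -
  have step: "f (orb t n a) - f (orb t' n a) = (orb t (Suc n) a - orb t' (Suc n) a) - (t - t')" for n
    by (simp add: orb_Suc)
  have 1: "orb t 1 a - orb t' 1 a = t - t'" by (simp add: orb_Suc)
  have le_a: "vle (orb t n a - orb t' n a) a" for n
    using assms by (intro vle_diff) (auto intro: veqD bounded_atD)
  have "vle (f (orb t n a) - f (orb t' n a)) a" for n
    unfolding step using le_a[of "Suc n"] le_a[of 1] unfolding 1 by (rule vle_diff)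
  hence le_w: "vle (orb t n a - orb t' n a) w" for n
    using assms by (intro pair_distance_le bounded_atD)
  have "vle (f (orb t 1 a) - f (orb t' 1 a)) w"
    unfolding step using le_w[of "Suc 1"] le_w[of 1] unfolding 1 by (rule vle_diff)
  hence "veq (orb t 1 a - orb t' 1 a) w \<or>
      vlt (orb t 1 a - orb t' 1 a) w \<and> vle ((orb t 1 a - orb t' 1 a) * w ^ (Q - 2)) 1"
    using assms by (intro pair_distance_cases bounded_atD)
  thus ?thesis unfolding 1 .
qed

text \<open>The first iterates of \<open>a\<close> and \<open>b\<close> under the same
  \<open>t\<close> differ by exactly \<open>f a - f b\<close>.\<close>

lemma value_distance:
  assumes "bounded_at t a" "bounded_at t b"
  shows "veq (f a - f b) w \<or> vlt (f a - f b) w \<and> vle ((f a - f b) * w ^ (Q - 2)) 1"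
proof -
  have "vle (orb t 2 a - orb t 2 b) w" by (rule orbit_pair_le[OF assms])
  hence "vle (f (orb t 1 a) - f (orb t 1 b)) w" by (simp add: orb_Suc numeral_2_eq_2)
  hence "veq (orb t 1 a - orb t 1 b) w \<or>
      vlt (orb t 1 a - orb t 1 b) w \<and> vle ((orb t 1 a - orb t 1 b) * w ^ (Q - 2)) 1"
    using assms by (intro pair_distance_cases bounded_atD)
  thus ?thesis by (simp add: orb_Suc)
qed

text \<open>The displacement of the first iterate from \<open>a\<close> in units of
  \<open>w\<close>. Two parameters lie in one cluster exactly when their values of
  \<open>\<eta>\<close> are congruent modulo the maximal ideal.\<close>

definition \<eta> :: "'k \<Rightarrow> 'k" where "\<eta> t = (t + f a - a) / w"

lemma \<eta>_diff: "\<eta> t - \<eta> t' = (t - t') / w"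
  by (simp add: \<eta>_def flip: diff_divide_distrib)

lemma orb_\<eta>: "orb t 1 a = a + w * \<eta> t"
  using nonzero by (simp add: \<eta>_def orb_Suc)

lemma \<eta>_mem:
  assumes "bounded_at t a"
  shows "\<eta> t \<in> V"
proof -
  have "vle (w * \<eta> t) (w * 1)" using orbit_pair_le[OF assms assms, of 1 0] orb_\<eta> by simp
  thus ?thesis using vle_mult_cancel_left nonzero vle_1_iff by blast
qed

text \<open>The first two iterates are within |w|, so \<open>g (orb t 1 a) - g a\<close> is
  negligible against \<open>w ^ Q\<close>. Its expansion at \<open>a\<close> has leading part
  \<open>w ^ Q\<close> times the stated polynomial, because
  \<open>w ^ Q = a ^ (s - 1) * w\<close>.\<close>

lemma \<eta>_root_Q:
  assumes "bounded_at t a"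
  shows "vlt (z * \<eta> t ^ Q + u * of_nat s * \<eta> t) 1"
proof (cases "\<eta> t = 0")
  case True
  thus ?thesis using s_less_Q by (simp add: power_0_left)
next
  case False
  let ?y = "w * \<eta> t"
  have yw: "vle ?y w" using orbit_pair_le[OF assms assms, of 1 0] orb_\<eta> by simp
  have ya: "vlt ?y a" using yw w_less_a vle_vlt_trans by blast
  define T where "T = (a + ?y) ^ s - a ^ s - of_nat s * a ^ (s - 1) * ?y"
  have "vlt T (a ^ (s - 1) * ?y)"
    unfolding T_def using ya False nonzero s_ge_3 by (intro binomial_first_order) auto
  also have "vle \<dots> (a ^ (s - 1) * w)" using yw by (intro vle_mult) auto
  finally have T: "vlt T (w ^ Q)" by (simp add: w_Q)
  have "vle (orb t 2 a - orb t 1 a) w" by (rule orbit_pair_le[OF assms assms])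
  hence "vle (f (orb t 1 a) - f a) w" by (simp add: orb_Suc numeral_2_eq_2)
  hence "vle (g (orb t 1 a) - g a) w"
    using vle_of_power_e w_gt_1 vlt_imp_vle unfolding f_diff by blast
  moreover have "vlt w (w ^ Q)" using power_vlt_power[OF w_gt_1, of 1 Q] s_less_Q s_ge_3 by simp
  ultimately have G: "vlt (g (orb t 1 a) - g a) (w ^ Q)" using vle_vlt_trans by blast
  have "g (orb t 1 a) - g a = z * ?y ^ Q + u * (of_nat s * a ^ (s - 1) * ?y + T)"
    unfolding g_diff orb_\<eta> by (simp add: T_def)
  also have "\<dots> = w ^ Q * (z * \<eta> t ^ Q + u * of_nat s * \<eta> t) + u * T"
    unfolding power_mult_distrib by (simp add: w_Q algebra_simps)
  finally have "w ^ Q * (z * \<eta> t ^ Q + u * of_nat s * \<eta> t) = (g (orb t 1 a) - g a) - u * T"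
    by simp
  hence "vlt (w ^ Q * (z * \<eta> t ^ Q + u * of_nat s * \<eta> t)) (w ^ Q * 1)"
    using G T unit_mult_vlt[OF unit_u] by (simp add: vlt_diff)
  thus ?thesis using vlt_mult_cancel_left[of "w ^ Q"] nonzero by (metis power_eq_0_iff)
qed

end

section \<open>Counting clusters of parameters\<close>

text \<open>Absorption relates this coefficient to
  \<open>Suc (p ^ j * m) * (p ^ j * m choose p ^ j)\<close>; both factors are prime to
  \<open>p\<close>, the second by the count from Sylow theory.\<close>

lemma prime_power_binomial_ndvd:
  fixes p :: nat
  assumes p: "prime p" and m: "\<not> p dvd m" and s: "\<not> p dvd Suc (p ^ j * m)"
  shows "\<not> p dvd (Suc (p ^ j * m) choose Suc (p ^ j))"
proof
  assume dvd: "p dvd (Suc (p ^ j * m) choose Suc (p ^ j))"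
  have "m > 0" using m by (cases m) auto
  have "multiplicity p (p ^ j * m choose p ^ j) = 0"
    using const_p_fac[OF \<open>m > 0\<close> p, of j] m by (simp add: not_dvd_imp_multiplicity_0)
  moreover have "p ^ j * m choose p ^ j \<noteq> 0" using \<open>m > 0\<close> by (simp add: binomial_eq_0_iff)
  ultimately have "\<not> p dvd (p ^ j * m choose p ^ j)"
    using p by (simp add: prime_elem_multiplicity_eq_zero_iff)
  moreover have "p dvd Suc (p ^ j) * (Suc (p ^ j * m) choose Suc (p ^ j))" using dvd by simp
  hence "p dvd Suc (p ^ j * m) * (p ^ j * m choose p ^ j)" by (simp only: Suc_times_binomial_eq mult.commute)
  ultimately show False using p s prime_dvd_mult_iff by blast
qed

text \<open>By Pascal's rule it suffices to treat \<open>p ^ j * m choose i\<close> for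
  \<open>0 < i < p ^ j\<close>. There \<open>i\<close> times the coefficient is a multiple of
  \<open>p ^ j\<close>, while \<open>p ^ j\<close> does not divide \<open>i\<close>.\<close>

lemma prime_power_binomial_dvd:
  fixes p :: nat
  assumes p: "prime p" and i: "1 < i" "i < p ^ j"
  shows "p dvd (Suc (p ^ j * m) choose i)"
proof -
  have dvd: "p dvd (p ^ j * m choose i)" if i: "0 < i" "i < p ^ j" for i
  proof (cases "m = 0")
    case False
    obtain i' where i': "i = Suc i'" using i by (cases i) auto
    obtain n where n: "p ^ j * m = Suc n" using False p by (metis mult_is_0 not0_implies_Suc power_not_zero not_prime_0)
    have "Suc i' * (Suc n choose Suc i') = Suc n * (n choose i')" by (simp only: Suc_times_binomial)
    hence eq: "p ^ j dvd i * (p ^ j * m choose i)" unfolding n i' by (metis dvd_mult2 dvd_triv_left n)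
    show ?thesis
    proof (rule ccontr)
      assume "\<not> p dvd (p ^ j * m choose i)"
      hence "coprime (p ^ j) (p ^ j * m choose i)" using p by (simp add: prime_imp_coprime)
      hence "p ^ j dvd i" using eq coprime_dvd_mult_left_iff by blast
      thus False using i by (simp add: nat_dvd_not_less)
    qed
  qed (use i in \<open>cases i; auto\<close>)
  obtain i' where i': "i = Suc i'" using i by (cases i) auto
  show ?thesis unfolding i' using dvd[of i'] dvd[of "Suc i'"] i i' by auto
qed

text \<open>Cauchy--Schwarz over the classes.\<close>

lemma card_related_pairs:
  assumes S: "finite S" and R: "equiv S R" and q: "card (S // R) \<le> q"
  shows "card S ^ 2 \<le> q * card R"
proof -
  let ?C = "S // R"
  have finC: "finite ?C" using S R by (metis equiv_type finite_quotient)
  have finX: "finite X" if "X \<in> ?C" for X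
    using that S R by (metis equiv_type finite_equiv_class)
  have S_eq: "card S = (\<Sum>X\<in>?C. card X)"
    using card_Union_disjoint[of ?C] finX quotient_disj[OF R] Union_quotient[OF R]
    by (simp add: pairwise_def disjnt_def) blast
  have R_eq: "R = (\<Union>X\<in>?C. X \<times> X)"
  proof (intro equalityI subrelI)
    fix x y assume xy: "(x, y) \<in> R"
    hence x: "x \<in> S" using equiv_type[OF R] by blast
    have "x \<in> R `` {x}" "y \<in> R `` {x}" using equiv_class_self[OF R x] xy by auto
    thus "(x, y) \<in> (\<Union>X\<in>?C. X \<times> X)" using quotientI[OF x, of R] by blast
  next
    fix x y assume "(x, y) \<in> (\<Union>X\<in>?C. X \<times> X)"
    thus "(x, y) \<in> R" using in_quotient_imp_in_rel[OF R] by blast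
  qed
  have "card R = (\<Sum>X\<in>?C. card (X \<times> X))"
    unfolding R_eq[symmetric]
  proof (subst R_eq, rule card_UN_disjoint)
    show "\<forall>i\<in>?C. \<forall>j\<in>?C. i \<noteq> j \<longrightarrow> i \<times> i \<inter> j \<times> j = {}"
      using quotient_disj[OF R] by blast
  qed (use finC finX in auto)
  hence R_card: "card R = (\<Sum>X\<in>?C. card X ^ 2)"
    by (simp add: card_cartesian_product power2_eq_square)
  \<comment> \<open>Integers make the square of \<open>n X - n Y\<close> meaningful.\<close>
  define n where "n X = int (card X)" for X :: "'a set"
  have "2 * (\<Sum>X\<in>?C. n X)\<^sup>2 = (\<Sum>X\<in>?C. \<Sum>Y\<in>?C. 2 * (n X * n Y))"
    by (simp only: power2_eq_square sum_product) (simp only: sum_distrib_left)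
  also have "\<dots> \<le> (\<Sum>X\<in>?C. \<Sum>Y\<in>?C. (n X)\<^sup>2 + (n Y)\<^sup>2)"
  proof (intro sum_mono)
    fix X Y
    show "2 * (n X * n Y) \<le> (n X)\<^sup>2 + (n Y)\<^sup>2"
      using zero_le_power2[of "n X - n Y"] by (simp add: power2_diff mult.assoc)
  qed
  also have "\<dots> = 2 * (int (card ?C) * (\<Sum>X\<in>?C. (n X)\<^sup>2))"
    by (simp add: sum.distrib sum_distrib_left)
  finally have "int (card S ^ 2) \<le> int (card ?C * card R)"
    unfolding S_eq R_card n_def by simp
  hence "card S ^ 2 \<le> card ?C * card R" by linarith
  also have "\<dots> \<le> q * card R" using q by simp
  finally show ?thesis .
qed

context binomial_pole
begin

text \<open>Ordered pairs including the diagonal, so the cardinality is the sum of the squared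
  cluster sizes.\<close>

definition close :: "'k set \<Rightarrow> ('k \<times> 'k) set" where
  "close S = {(t, t'). t \<in> S \<and> t' \<in> S \<and> vlt (t - t') w}"

lemma equiv_close: "equiv S (close S)"
proof (rule equivI)
  show "refl_on S (close S)" using nonzero by (auto simp: refl_on_def close_def)
  show "close S \<subseteq> S \<times> S" by (auto simp: close_def)
  show "sym (close S)" using vle_minus_commute by (auto simp: sym_def close_def vlt_def)
      (metis vle_uminus minus_diff_eq vle_trans vle_refl)+
  show "trans (close S)"
  proof (rule transI)
    fix x y z assume "(x, y) \<in> close S" "(y, z) \<in> close S"
    thus "(x, z) \<in> close S" using vlt_add[of "x - y" w "y - z"] by (auto simp: close_def)
  qed
qed

text \<open>Representatives of distinct clusters have \<open>\<eta>\<close>-values differing by a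
  unit, by the dichotomy for parameter distances. They are thus incongruent roots of
  \<open>h\<close>, so \<open>degree h\<close> bounds the number of clusters.\<close>

lemma card_close_ge:
  assumes S: "finite S" and bdd: "\<And>t. t \<in> S \<Longrightarrow> bounded_at t a"
    and h: "\<And>i. coeff h i \<in> V" "veq (lead_coeff h) 1" "\<And>t. t \<in> S \<Longrightarrow> vlt (poly h (\<eta> t)) 1"
  shows "card S ^ 2 \<le> degree h * card (close S)"
proof (rule card_related_pairs[OF S equiv_close])
  let ?C = "S // close S"
  define rep where "rep X = (SOME t. t \<in> X)" for X :: "'k set"
  have rep: "rep X \<in> X" if "X \<in> ?C" for X
    unfolding rep_def using that equiv_close by (metis in_quotient_imp_non_empty some_in_eq)
  have rep_S: "rep X \<in> S" if "X \<in> ?C" for X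
    using rep[OF that] in_quotient_imp_subset[OF equiv_close that] by blast
  have sep: "veq (\<eta> (rep X) - \<eta> (rep Y)) 1" if XY: "X \<in> ?C" "Y \<in> ?C" "X \<noteq> Y" for X Y
  proof -
    have "(rep X, rep Y) \<notin> close S"
      using quotient_eqI[OF equiv_close XY(1,2) rep[OF XY(1)] rep[OF XY(2)]] XY(3) by blast
    hence "\<not> vlt (rep X - rep Y) w" using rep_S XY by (auto simp: close_def)
    hence "veq (rep X - rep Y) w" using parameter_distance bdd rep_S XY by blast
    hence "veq (inverse w * (rep X - rep Y)) (inverse w * w)" by (intro veq_mult) auto
    thus ?thesis using nonzero by (simp add: \<eta>_diff divide_inverse mult.commute)
  qed
  have inj: "inj_on (\<lambda>X. \<eta> (rep X)) ?C"
    using sep by (force simp: inj_on_def veq_def)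
  have "card ((\<lambda>X. \<eta> (rep X)) ` ?C) \<le> degree h"
  proof (rule card_incongruent_roots[OF h(1,2)])
    show "finite ((\<lambda>X. \<eta> (rep X)) ` ?C)"
      using S equiv_close by (metis equiv_type finite_imageI finite_quotient)
    show "(\<lambda>X. \<eta> (rep X)) ` ?C \<subseteq> V" using \<eta>_mem bdd rep_S by blast
    show "veq (x - y) 1" if "x \<in> (\<lambda>X. \<eta> (rep X)) ` ?C" "y \<in> (\<lambda>X. \<eta> (rep X)) ` ?C" "x \<noteq> y" for x y
      using that sep by blast
    show "vlt (poly h x) 1" if "x \<in> (\<lambda>X. \<eta> (rep X)) ` ?C" for x
      using that h(3) rep_S by blast
  qed
  thus "card ?C \<le> degree h" using card_image[OF inj] by simp
qed

lemma card_close_Q: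
  assumes S: "finite S" and bdd: "\<And>t. t \<in> S \<Longrightarrow> bounded_at t a"
  shows "card S ^ 2 \<le> Q * card (close S)"
proof -
  define h where "h = monom z Q + monom (u * of_nat s) 1"
  have Q: "Q > 1" using s_less_Q s_ge_3 by simp
  have "z \<noteq> 0" using unit_z by (auto simp: veq_def)
  have "degree (monom (u * of_nat s) 1) < degree (monom z Q)"
    using Q \<open>z \<noteq> 0\<close> by (intro le_less_trans[OF degree_monom_le]) (simp add: degree_monom_eq)
  hence deg: "degree h = Q"
    unfolding h_def using \<open>z \<noteq> 0\<close> by (simp add: degree_add_eq_left degree_monom_eq)
  have "z \<in> V" "u * of_nat s \<in> V" using unit_z unit_u of_nat_mem by (auto simp: veq_def vle_1_iff intro: mult_mem)
  hence "coeff h i \<in> V" for i using Q zero_mem by (auto simp: h_def)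
  moreover have "veq (lead_coeff h) 1" unfolding deg using Q unit_z by (simp add: h_def)
  moreover have "vlt (poly h (\<eta> t)) 1" if "t \<in> S" for t
    using \<eta>_root_Q[OF bdd[OF that]] by (simp add: h_def poly_monom)
  ultimately show ?thesis using card_close_ge[OF S bdd, of h] deg by simp
qed

lemma power_w_a_less:
  assumes "i < j" "j \<le> s"
  shows "vlt (a ^ (s - j) * w ^ j) (a ^ (s - i) * w ^ i)"
proof -
  have "vlt (w ^ (j - i)) (a ^ (j - i))" using assms w_less_a by (intro vlt_power) auto
  hence "vlt (a ^ (s - j) * w ^ i * w ^ (j - i)) (a ^ (s - j) * w ^ i * a ^ (j - i))"
    using nonzero by (simp add: vlt_mult_cancel_left)
  also have "a ^ (s - j) * w ^ i * a ^ (j - i) = a ^ (s - j + (j - i)) * w ^ i"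
    by (simp only: power_add mult_ac)
  also have "s - j + (j - i) = s - i" using assms by simp
  finally show ?thesis using assms by (simp add: mult.assoc flip: power_add)
qed

text \<open>The second difference of \<open>x\<^sup>s\<close> has leading term
  \<open>(s choose P + 1) a^(s-P-1) w^(P+1) (\<theta> \<eta>\<^sup>P + \<theta>\<^sup>P \<eta>)\<close>, because all earlier
  nonzero terms of the binomial expansion are additive.\<close>

lemma \<eta>_root_P:
  assumes t: "bounded_at t a" "bounded_at t b" and t': "bounded_at t' a" "bounded_at t' b"
    and \<gamma>: "veq (f a - f b) w" and P: "P = p ^ j" and sP: "s = Suc (P * m)" and m: "\<not> p dvd m"
  defines "\<theta> \<equiv> (f a - f b) / w"
  shows "vlt (\<theta> * \<eta> t ^ P + \<theta> ^ P * \<eta> t - (\<theta> * \<eta> t' ^ P + \<theta> ^ P * \<eta> t')) 1"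
proof -
  \<comment> \<open>For \<open>x = \<eta> t\<close> these are the \<open>s\<close>-th powers of the
    first iterates of \<open>a\<close> and \<open>b\<close>.\<close>
  define D where "D x = (a + w * x) ^ s - (a + w * (x - \<theta>)) ^ s" for x
  define C where "C i = of_nat (s choose i) * a ^ (s - i) * w ^ i" for i
  define H where "H i x = x ^ i - (x - \<theta>) ^ i" for i x
  have w\<theta>: "w * \<theta> = f a - f b" using nonzero by (simp add: \<theta>_def)
  have "veq (w * \<theta>) (w * 1)" using \<gamma> w\<theta> by simp
  hence \<theta>: "veq \<theta> 1" using vle_mult_cancel_left nonzero unfolding veq_def by blast
  hence \<theta>V: "\<theta> \<in> V" by (simp add: veq_def vle_1_iff)
  have bound: "vle (z * (w * \<theta>) ^ Q + u * D (\<eta> t)) w" if t: "bounded_at t a" "bounded_at t b" for t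
  proof -
    have b1: "orb t 1 b = a + w * (\<eta> t - \<theta>)"
      using orb_\<eta>[of t] w\<theta> by (simp add: orb_Suc algebra_simps)
    have "vle (orb t 2 a - orb t 2 b) w" by (rule orbit_pair_le[OF t])
    hence "vle (f (orb t 1 a) - f (orb t 1 b)) w" by (simp add: orb_Suc numeral_2_eq_2)
    hence "vle (g (orb t 1 a) - g (orb t 1 b)) w"
      using vle_of_power_e w_gt_1 vlt_imp_vle unfolding f_diff by blast
    thus ?thesis unfolding g_diff unfolding orb_\<eta> b1 D_def by (simp add: algebra_simps)
  qed
  have "vle ((z * (w * \<theta>) ^ Q + u * D (\<eta> t)) - (z * (w * \<theta>) ^ Q + u * D (\<eta> t'))) w"
    using bound[OF t] bound[OF t'] by (rule vle_diff)
  \<comment> \<open>The \<open>Q\<close>-th power term is the same for both parameters and drops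
    out.\<close>
  hence "vle (u * (D (\<eta> t) - D (\<eta> t'))) w" by (simp add: right_diff_distrib)
  hence Dw: "vle (D (\<eta> t) - D (\<eta> t')) w" using unit_mult_vle[OF unit_u] by blast
  have "m > 0" using m by (cases m) auto
  have "P > 0" using P prime by (simp add: prime_gt_0_nat)
  have Ps: "Suc P \<le> s" using sP \<open>m > 0\<close> by simp
  define X where "X = a ^ (s - Suc P) * w ^ Suc P"
  have X: "X \<noteq> 0" using nonzero by (simp add: X_def)
  \<comment> \<open>\<open>X\<close> is the size of the term of index \<open>P + 1\<close>; the
    error \<open>w\<close> must be negligible against it.\<close>
  have wX: "vlt w X"
  proof -
    have "vlt w (w ^ Suc P)" using power_vlt_power[OF w_gt_1, of 1 "Suc P"] \<open>P > 0\<close> by simp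
    moreover have "vle 1 (a ^ (s - Suc P))" using vle_power[OF vlt_imp_vle[OF pole]] by force
    ultimately have "vlt (1 * w) (a ^ (s - Suc P) * w ^ Suc P)"
      using nonzero by (intro vle_vlt_mult) auto
    thus ?thesis by (simp add: X_def)
  qed
  have expand: "(a + w * x) ^ s = (\<Sum>i\<le>s. C i * x ^ i)" for x
    using binomial_ring[of "w * x" a s]
    by (simp add: C_def add.commute power_mult_distrib mult_ac)
  have D_sum: "D x = (\<Sum>i\<le>s. C i * H i x)" for x
    unfolding D_def expand H_def by (simp add: right_diff_distrib sum_subtractf)
  have HP: "H P x = \<theta> ^ P" for x
    unfolding H_def P frobenius_diff[OF prime char] by simp
  have HSP: "H (Suc P) x = \<theta> * x ^ P + \<theta> ^ P * x - \<theta> ^ Suc P" for x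
  proof -
    have "(x - \<theta>) ^ P = x ^ P - \<theta> ^ P" unfolding P by (rule frobenius_diff[OF prime char])
    hence "H (Suc P) x = x * x ^ P - (x - \<theta>) * (x ^ P - \<theta> ^ P)" by (simp add: H_def)
    thus ?thesis by (simp add: algebra_simps)
  qed
  \<comment> \<open>For \<open>i\<close> equal to 0, 1 or \<open>P\<close> the difference
    \<open>H i x\<close> is independent of \<open>x\<close>; strictly between 1 and \<open>P\<close>
    the binomial coefficient vanishes modulo \<open>p\<close>.\<close>
  have low: "C i * H i x = C i * H i x'" if "i \<le> P" for i x x'
  proof -
    consider "i = 0" | "i = 1" | "i = P" | "1 < i" "i < P" using \<open>i \<le> P\<close> by linarith
    thus ?thesis
    proof cases
      case 4
      have "p dvd (s choose i)" unfolding sP P using 4 P by (intro prime_power_binomial_dvd prime) auto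
      hence "of_nat (s choose i) = (0 :: 'k)" using char by (simp add: of_nat_eq_0_iff_char_dvd)
      thus ?thesis by (simp add: C_def)
    qed (simp_all add: H_def[of 0] H_def[of "Suc 0"] HP)
  qed
  have split: "(\<Sum>i\<le>s. F i) = (\<Sum>i\<le>P. F i) + F (Suc P) + (\<Sum>i\<in>{Suc P<..s}. F i)" for F :: "nat \<Rightarrow> 'k"
  proof -
    have "{..s} = insert (Suc P) ({..P} \<union> {Suc P<..s})" using Ps by auto
    moreover have "{..P} \<inter> {Suc P<..s} = {}" by auto
    ultimately show ?thesis by (simp add: sum.union_disjoint)
  qed
  have "D (\<eta> t) - D (\<eta> t') = (\<Sum>i\<le>s. C i * H i (\<eta> t) - C i * H i (\<eta> t'))"
    unfolding D_sum by (simp add: sum_subtractf)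
  also have "\<dots> = C (Suc P) * (H (Suc P) (\<eta> t) - H (Suc P) (\<eta> t'))
      + (\<Sum>i\<in>{Suc P<..s}. C i * H i (\<eta> t) - C i * H i (\<eta> t'))"
  proof -
    have "(\<Sum>i\<le>P. C i * H i (\<eta> t) - C i * H i (\<eta> t')) = 0"
      by (intro sum.neutral) (use low[of _ "\<eta> t" "\<eta> t'"] in auto)
    thus ?thesis unfolding split by (simp add: right_diff_distrib)
  qed
  finally have main: "C (Suc P) * (H (Suc P) (\<eta> t) - H (Suc P) (\<eta> t')) =
      (D (\<eta> t) - D (\<eta> t')) - (\<Sum>i\<in>{Suc P<..s}. C i * H i (\<eta> t) - C i * H i (\<eta> t'))"
    by simp
  have H_mem: "H i (\<eta> t) \<in> V" if "bounded_at t a" for i t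
    unfolding H_def using \<eta>_mem[OF that] \<theta>V by (intro diff_mem power_mem)
  have "vlt (C i * H i (\<eta> t) - C i * H i (\<eta> t')) X" if i: "i \<in> {Suc P<..s}" for i
  proof -
    have "vle (of_nat (s choose i) * (a ^ (s - i) * w ^ i) * (H i (\<eta> t) - H i (\<eta> t')))
        (1 * (a ^ (s - i) * w ^ i) * 1)"
      using H_mem[OF t(1), of i] H_mem[OF t'(1), of i] by (intro vle_mult vle_diff vle_of_nat vle_refl)
        (auto simp: vle_1_iff)
    moreover have "vlt (a ^ (s - i) * w ^ i) X" unfolding X_def using i by (intro power_w_a_less) auto
    ultimately show ?thesis
      using vle_vlt_trans by (simp add: C_def mult.assoc right_diff_distrib)
  qed
  hence "vlt (\<Sum>i\<in>{Suc P<..s}. C i * H i (\<eta> t) - C i * H i (\<eta> t')) X" using X by (intro vlt_sum)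
  hence "vlt (C (Suc P) * (H (Suc P) (\<eta> t) - H (Suc P) (\<eta> t'))) X"
    unfolding main using vle_vlt_trans[OF Dw wX] by (rule vlt_diff[rotated])
  moreover have "\<not> p dvd (s choose Suc P)"
    using prime_power_binomial_ndvd[OF prime m, of j] s_ndvd unfolding sP P by blast
  hence "veq (of_nat (s choose Suc P)) 1" by (rule unit_of_nat[OF prime char])
  moreover have "C (Suc P) * (H (Suc P) (\<eta> t) - H (Suc P) (\<eta> t')) =
      of_nat (s choose Suc P) * (X * (H (Suc P) (\<eta> t) - H (Suc P) (\<eta> t')))"
    by (simp add: C_def X_def mult.assoc)
  ultimately have "vlt (X * (H (Suc P) (\<eta> t) - H (Suc P) (\<eta> t'))) (X * 1)"
    using unit_mult_vlt by simp
  hence "vlt (H (Suc P) (\<eta> t) - H (Suc P) (\<eta> t')) 1" using vlt_mult_cancel_left[OF X] by blast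
  thus ?thesis unfolding HSP by (simp add: algebra_simps)
qed

text \<open>By \<open>\<eta>_root_P\<close> all \<open>\<eta>\<close>-values are roots modulo the
  maximal ideal of \<open>\<theta> * X ^ P + \<theta> ^ P * X - \<kappa>\<close>, where
  \<open>\<kappa>\<close> is the value at one fixed parameter \<open>t0\<close>.\<close>

lemma card_close_P:
  assumes S: "finite S" and bdd: "\<And>t. t \<in> S \<Longrightarrow> bounded_at t a" "\<And>t. t \<in> S \<Longrightarrow> bounded_at t b"
    and \<gamma>: "veq (f a - f b) w" and P: "P = p ^ j" and sP: "s = Suc (P * m)" and m: "\<not> p dvd m"
  shows "card S ^ 2 \<le> P * card (close S)"
proof (cases "S = {}")
  case False
  then obtain t0 where t0: "t0 \<in> S" by blast
  define \<theta> where "\<theta> = (f a - f b) / w"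
  define \<kappa> where "\<kappa> = \<theta> * \<eta> t0 ^ P + \<theta> ^ P * \<eta> t0"
  have "w * \<theta> = f a - f b" using nonzero by (simp add: \<theta>_def)
  hence "veq (w * \<theta>) (w * 1)" using \<gamma> by simp
  hence \<theta>: "veq \<theta> 1" using vle_mult_cancel_left nonzero unfolding veq_def by blast
  hence \<theta>V: "\<theta> \<in> V" by (simp add: veq_def vle_1_iff)
  have \<theta>0: "\<theta> \<noteq> 0" using \<theta> by (auto simp: veq_def)
  have \<kappa>: "\<kappa> \<in> V" unfolding \<kappa>_def using \<theta>V \<eta>_mem bdd t0 by (intro add_mem mult_mem power_mem) auto
  define h where "h = monom \<theta> P + monom (\<theta> ^ P) 1 - [:\<kappa>:]"
  have Ph: "poly h x = \<theta> * x ^ P + \<theta> ^ P * x - \<kappa>" for x by (simp add: h_def poly_monom)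
  have memh: "coeff h i \<in> V" for i
    unfolding h_def coeff_add coeff_diff using \<theta>V \<kappa> zero_mem power_mem[OF \<theta>V, of P]
    by (intro add_mem diff_mem) (auto simp: coeff_pCons split: nat.splits)
  have "P > 0" using P prime by (simp add: prime_gt_0_nat)
  \<comment> \<open>For \<open>P = 1\<close> both monomials merge and the leading coefficient is
    \<open>2 * \<theta>\<close>. Then \<open>p = 2\<close> cannot occur, since \<open>m\<close> and
    \<open>s = m + 1\<close> would both be odd.\<close>
  have two: "veq (of_nat 2) 1" if "P = 1"
  proof (rule unit_of_nat[OF prime char])
    show "\<not> p dvd 2"
    proof
      assume "p dvd 2"
      hence "p = 2" using prime by (metis prime_nat_iff two_is_prime_nat primes_dvd_imp_eq)
      thus False using that sP s_ndvd m by simp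
    qed
  qed
  have coeffP: "veq (coeff h P) 1"
  proof (cases "P = 1")
    case True
    have "coeff h P = \<theta> + \<theta>" unfolding h_def coeff_add coeff_diff using True by simp
    hence "coeff h P = of_nat 2 * \<theta>" by simp
    thus ?thesis using veq_mult[OF two[OF True] \<theta>] by simp
  next
    case False
    thus ?thesis using \<open>P > 0\<close> \<theta> by (simp add: h_def coeff_pCons split: nat.splits)
  qed
  have "degree h \<le> P" unfolding h_def using \<open>P > 0\<close>
    by (intro degree_diff_le degree_add_le order.trans[OF degree_monom_le]) auto
  moreover have "coeff h P \<noteq> 0" using coeffP by (auto simp: veq_def)
  hence "P \<le> degree h" by (rule le_degree)
  ultimately have deg: "degree h = P" by simp
  have "vlt (poly h (\<eta> t)) 1" if "t \<in> S" for t
    unfolding Ph \<kappa>_def \<theta>_def using bdd that t0 by (intro \<eta>_root_P[OF _ _ _ _ \<gamma> P sP m]) auto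
  thus ?thesis using card_close_ge[OF S bdd(1), of h] memh coeffP deg by simp
qed auto

text \<open>\<open>A\<close> counts the off-diagonal close pairs, each contributing at most
  |w|^(-(Q-2)); \<open>D\<close> counts the far pairs, each contributing at most |w|.\<close>

lemma prod_distances:
  assumes S: "finite S" and bdd: "\<And>t. t \<in> S \<Longrightarrow> bounded_at t a"
  defines "A \<equiv> card (close S) - card S" and "D \<equiv> card S ^ 2 - card (close S)"
  shows "vle ((\<Prod>(t, t')\<in>S \<times> S - Id. t - t') * w ^ ((Q - 2) * A)) (w ^ D)"
proof -
  let ?d = "\<lambda>(t, t'). t - t' :: 'k"
  define N where "N = close S - Id"
  define F where "F = S \<times> S - close S"
  have fin: "finite (close S)" 
    by (rule finite_subset[OF _ finite_cartesian_product[OF S S]]) (auto simp: close_def)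
  have diag: "Id_on S \<subseteq> close S" using nonzero by (auto simp: close_def)
  have "N = close S - Id_on S" by (auto simp: N_def close_def)
  moreover have "Id_on S = (\<lambda>x. (x, x)) ` S" by auto
  hence "card (Id_on S) = card S" by (simp add: card_image inj_on_def)
  ultimately have cN: "card N = A" unfolding A_def using diag fin
    by (simp add: card_Diff_subset finite_subset)
  have "close S \<subseteq> S \<times> S" by (auto simp: close_def)
  hence cF: "card F = D" unfolding D_def F_def using fin
    by (simp add: card_Diff_subset card_cartesian_product power2_eq_square)
  have finN: "finite N" "finite F" using fin S by (auto simp: N_def F_def)
  have split: "S \<times> S - Id = N \<union> F" "N \<inter> F = {}" using diag by (auto simp: N_def F_def close_def)
  have "vle (prod ?d M * w ^ ((Q - 2) * card M)) 1" if "finite M" "M \<subseteq> N" for M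
    using that
  proof (induction M rule: finite_induct)
    case empty
    show ?case by simp
  next
    case (insert x M)
    obtain t t' where x: "x = (t, t')" by (cases x)
    hence "vlt (t - t') w" "t \<in> S" "t' \<in> S" using insert by (auto simp: N_def close_def)
    hence "vle ((t - t') * w ^ (Q - 2)) 1"
      using parameter_distance[of t t'] bdd by (auto simp: veq_def vlt_def)
    from vle_mult[OF this insert.IH] show ?case
      using insert by (simp add: x power_add mult_ac)
  qed
  moreover have "vle (prod ?d M) (w ^ card M)" if "finite M" "M \<subseteq> F" for M
    using that
  proof (induction M rule: finite_induct)
    case empty
    show ?case by simp
  next
    case (insert x M)
    obtain t t' where x: "x = (t, t')" by (cases x)
    hence "t \<in> S" "t' \<in> S" using insert by (auto simp: F_def)
    hence "vle (t - t') w" using parameter_distance[of t t'] bdd vlt_imp_vle by (auto simp: veq_def)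
    from vle_mult[OF this insert.IH] show ?case using insert by (simp add: x)
  qed
  ultimately have "vle (prod ?d N * w ^ ((Q - 2) * card N) * prod ?d F) (1 * w ^ card F)"
    using finN by (intro vle_mult) auto
  thus ?thesis unfolding split(1) using finN split(2)
    by (simp add: prod.union_disjoint cN cF mult_ac)
qed

end

section \<open>The discriminant estimate\<close>

context binomial_pole
begin

text \<open>Let \<open>c\<close> be the number of close pairs. If |f a - f b| = |w|, then
  \<open>c \<ge> 18 * Q\<close>, and the close pairs outweigh both the far pairs and the power of
  \<open>f a - f b\<close>. Otherwise only \<open>c \<ge> 9 * Q\<close> is known, but now that power
  is itself small; the exponent \<open>3 * Q + 19\<close> makes
  \<open>(Q - 2) * (9 * Q + 19)\<close> exceed \<open>9 * Q ^ 2 - 9 * Q\<close>.\<close>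

lemma discriminant_small:
  assumes S: "finite S" "card S = 3 * Q"
    and bdd: "\<And>t. t \<in> S \<Longrightarrow> bounded_at t a" "\<And>t. t \<in> S \<Longrightarrow> bounded_at t b"
  shows "vlt ((f a - f b) ^ (3 * Q + 19) * (\<Prod>(t, t')\<in>S \<times> S - Id. t - t')) 1"
proof -
  let ?\<gamma> = "f a - f b"
  define m where "m = 3 * Q + 19"
  define c where "c = card (close S)"
  define diffs where "diffs = (\<Prod>(t, t')\<in>S \<times> S - Id. t - t')"
  define A where "A = c - 3 * Q"
  define D where "D = 9 * Q ^ 2 - c"
  \<comment> \<open>As \<open>Q \<ge> 4\<close>, substituting \<open>Q = x + 4\<close> turns the
    final inequalities into comparisons of polynomials in \<open>x\<close> whose difference has
    positive coefficients.\<close>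
  define x where "x = Q - 4"
  have Q: "Q = x + 4" using s_less_Q s_ge_3 by (simp add: x_def)
  have prod: "vle (diffs * w ^ ((Q - 2) * A)) (w ^ D)"
    using prod_distances[OF S(1) bdd(1)] S(2)
    by (simp add: diffs_def A_def D_def c_def power_mult_distrib)
  have conclude: "vlt (?\<gamma> ^ m * diffs) 1"
    if "vle (?\<gamma> ^ m * diffs * w ^ i) (w ^ j)" "j < i" for i j
  proof -
    have "vlt (w ^ j) (w ^ i)" using that(2) by (rule power_vlt_power[OF w_gt_1])
    hence "vlt (?\<gamma> ^ m * diffs * w ^ i) (1 * w ^ i)" using that(1) vle_vlt_trans by simp
    thus ?thesis using nonzero by (simp add: vlt_mult_cancel_right[of "w ^ i"] del: mult_1_left)
  qed
  obtain t where "t \<in> S" using S Q by fastforce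
  hence "veq ?\<gamma> w \<or> vlt ?\<gamma> w \<and> vle (?\<gamma> * w ^ (Q - 2)) 1"
    using value_distance bdd by blast
  thus ?thesis
  proof
    assume \<gamma>: "veq ?\<gamma> w"
    obtain r where r: "s - 1 = p ^ multiplicity p (s - 1) * r" "\<not> p dvd r"
    proof (rule multiplicity_decompose')
      show "s - 1 \<noteq> 0" using s_ge_3 by simp
      show "\<not> p dvd 1" using prime not_prime_unit by blast
    qed
    define j where "j = multiplicity p (s - 1)"
    define P where "P = p ^ j"
    have s: "s = Suc (P * r)" using r(1) s_ge_3 by (simp add: P_def j_def)
    have "r > 0" using r(2) by (cases r) auto
    have "P * 1 \<le> P * r" using \<open>r > 0\<close> by (intro mult_le_mono2) simp
    hence "p ^ j < p ^ k" using s s_less unfolding P_def by linarith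
    hence "j < k" using prime_gt_1_nat[OF prime] power_less_imp_less_exp by blast
    hence "p ^ Suc j \<le> p ^ k" using prime_gt_0_nat[OF prime] by (intro power_increasing) auto
    moreover have "2 * p ^ j \<le> p ^ Suc j" using prime_ge_2_nat[OF prime] by simp
    \<comment> \<open>Both are powers of \<open>p\<close>, and
      \<open>P \<le> s - 1 < Q\<close>.\<close>
    ultimately have PQ: "2 * P \<le> Q" unfolding P_def Q_def by linarith
    have "(3 * Q) ^ 2 \<le> P * c"
      using card_close_P[OF S(1) bdd \<gamma> P_def s r(2)] S(2) by (simp add: c_def)
    hence "Q * (18 * Q) \<le> 2 * P * c" by (simp add: power2_eq_square)
    also have "\<dots> \<le> Q * c" using PQ by (rule mult_le_mono1)
    finally have c: "18 * Q \<le> c" using Q by simp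
    hence "vle (?\<gamma> ^ m * diffs * w ^ ((Q - 2) * A)) (w ^ (m + D))"
      using vle_mult[OF vle_power[OF veqD(1)[OF \<gamma>], of m] prod] by (simp add: power_add mult_ac)
    moreover have "m + D < (Q - 2) * A"
    proof -
      have "(Q - 2) * (15 * Q) \<le> (Q - 2) * A" using c by (intro mult_le_mono2) (simp add: A_def)
      moreover have "m + D \<le> m + (9 * Q ^ 2 - 18 * Q)" using c by (simp add: D_def)
      moreover have "m + (9 * Q ^ 2 - 18 * Q) < (Q - 2) * (15 * Q)"
        unfolding m_def Q by (simp add: power2_eq_square algebra_simps)
      ultimately show ?thesis by linarith
    qed
    ultimately show ?thesis using conclude unfolding diffs_def m_def by blast
  next
    assume "vlt ?\<gamma> w \<and> vle (?\<gamma> * w ^ (Q - 2)) 1"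
    hence "vle ((?\<gamma> * w ^ (Q - 2)) ^ m) (1 ^ m)" using vle_power by blast
    hence "vle (?\<gamma> ^ m * w ^ ((Q - 2) * m)) 1" by (simp add: power_mult_distrib power_mult)
    from vle_mult[OF this prod] have "vle (?\<gamma> ^ m * diffs * w ^ ((Q - 2) * (A + m))) (w ^ D)"
      by (simp add: power_add distrib_left distrib_right mult_ac)
    moreover have "D < (Q - 2) * (A + m)"
    proof -
      have "(3 * Q) ^ 2 \<le> Q * c" using card_close_Q[OF S(1) bdd(1)] S(2) by (simp add: c_def)
      hence "Q * (9 * Q) \<le> Q * c" by (simp add: power2_eq_square)
      hence c: "9 * Q \<le> c" using Q by simp
      have "(Q - 2) * (6 * Q + m) \<le> (Q - 2) * (A + m)" using c by (intro mult_le_mono2) (simp add: A_def)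
      moreover have "D \<le> 9 * Q ^ 2 - 9 * Q" using c by (simp add: D_def)
      moreover have "9 * Q ^ 2 - 9 * Q < (Q - 2) * (6 * Q + m)"
        unfolding m_def Q by (simp add: power2_eq_square algebra_simps)
      ultimately show ?thesis by linarith
    qed
    ultimately show ?thesis using conclude unfolding diffs_def m_def by blast
  qed
qed

end

section \<open>The family of binomials\<close>

locale binomial_family =
  fixes p l1 l2 s :: nat and c1 c2 :: "'k::alg_closed_field"
  assumes prime: "prime p" and char: "CHAR('k) = p"
    and c1: "c1 \<in> Fp_bar" "c1 \<noteq> 0" and c2: "c2 \<in> Fp_bar" "c2 \<noteq> 0"
    and less: "p ^ l1 * s < p ^ l2" and s_ndvd: "\<not> p dvd s" and s_ge_3: "3 \<le> s"
begin

definition F :: "'k poly" where "F = monom c1 (p ^ l1 * s) + monom c2 (p ^ l2)"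

definition k :: nat where "k = l2 - l1"

lemma l1_less_l2: "l1 < l2"
proof (rule ccontr)
  assume "\<not> l1 < l2"
  hence "p ^ l2 \<le> p ^ l1" using prime_gt_0_nat[OF prime] by (intro power_increasing) auto
  also have "\<dots> \<le> p ^ l1 * s" using s_ge_3 by simp
  finally show False using less by simp
qed

lemma p_power_l2: "p ^ l2 = p ^ k * p ^ l1"
  using l1_less_l2 by (simp add: k_def flip: power_add)

lemma s_less: "s < p ^ k"
  using less prime_gt_0_nat[OF prime] unfolding p_power_l2 by (simp add: mult.commute)

lemma Fp_bar_root:
  assumes "x ^ n \<in> Fp_bar" "n > 0"
  shows "x \<in> (Fp_bar :: 'k set)"
proof (rule Fp_bar_algebraically_closed[OF prime char])
  let ?h = "monom 1 n - [:x ^ n:]"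
  have "coeff ?h n = 1" using assms(2) by (cases n) auto
  thus "?h \<noteq> 0" by (metis coeff_0 zero_neq_one)
  show "coeff ?h i \<in> Fp_bar" for i
    unfolding coeff_diff using assms Fp_bar_0[OF prime char] Fp_bar_1[OF prime char]
    by (intro Fp_bar_diff[OF prime char]) (auto simp: coeff_pCons split: nat.splits)
  show "poly ?h x = 0" by (simp add: poly_monom)
qed

text \<open>Taking \<open>p ^ l1\<close>-th roots of the coefficients exhibits \<open>F\<close> as a
  full \<open>p ^ l1\<close>-th power, the shape assumed in \<open>binomial_place\<close>.\<close>

definition z :: 'k where "z = (SOME z. z ^ (p ^ l1) = c2)"

definition u :: 'k where "u = (SOME u. u ^ (p ^ l1) = c1)"

lemma z_u: "z ^ (p ^ l1) = c2" "u ^ (p ^ l1) = c1"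
  unfolding z_def u_def
  by (rule someI_ex, rule nth_root_exists, simp add: prime_gt_0_nat[OF prime])+

lemma z_u_Fp_bar: "z \<in> Fp_bar" "u \<in> Fp_bar"
  using z_u c1 c2 Fp_bar_root[of _ "p ^ l1"] prime_gt_0_nat[OF prime] by auto

lemma z_u_nonzero: "z \<noteq> 0" "u \<noteq> 0"
  using z_u c1 c2 prime_gt_0_nat[OF prime] by (auto simp: power_0_left)

lemma Fp_bar_unit:
  fixes V :: "'k set"
  assumes "valuation_ring V" "Fp_bar \<subseteq> V" "x \<in> Fp_bar" "x \<noteq> (0::'k)"
  shows "valuation_ring.veq V x 1"
proof -
  interpret valuation_ring V by fact
  have "inverse x \<in> V" "x \<in> V" using assms Fp_bar_inverse[OF prime char] by auto
  hence "vle x 1" "vle 1 x" using assms(4) by (auto simp: vle_def intro!: bexI[of _ "inverse x"])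
  thus ?thesis by (simp add: veq_def)
qed

lemma binomial_place:
  fixes V :: "'k set"
  assumes V: "valuation_ring V" "Fp_bar \<subseteq> V"
  shows "binomial_place V p k s z u"
proof -
  interpret valuation_ring V by fact
  show ?thesis
    using prime char Fp_bar_unit[OF V] z_u_Fp_bar z_u_nonzero s_ge_3 s_less s_ndvd
    by unfold_locales auto
qed

lemma poly_F: "poly F x = (z * x ^ (p ^ k) + u * x ^ s) ^ (p ^ l1)"
proof -
  have "(z * x ^ (p ^ k) + u * x ^ s) ^ (p ^ l1) = (z * x ^ (p ^ k)) ^ (p ^ l1) + (u * x ^ s) ^ (p ^ l1)"
    by (rule freshmans_dream'[where n = l1]) (use prime char in auto)
  thus ?thesis
    by (simp add: F_def poly_monom power_mult_distrib z_u p_power_l2 add.commute mult.commute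
        flip: power_mult)
qed

lemma place_f:
  fixes V :: "'k set"
  assumes "valuation_ring V" "Fp_bar \<subseteq> V"
  shows "binomial_place.f p l1 k s z u x = poly F x"
proof -
  interpret binomial_place V p l1 k s z u using binomial_place[OF assms] .
  show ?thesis by (simp add: f_def g_def Q_def e_def poly_F)
qed

text \<open>Used mainly in contrapositive form: an element integral at every place above
  \<open>Fp_bar\<close> belongs to \<open>Fp_bar\<close>.\<close>

lemma exists_place:
  assumes "x \<notin> (Fp_bar :: 'k set)"
  shows "\<exists>V. valuation_ring V \<and> Fp_bar \<subseteq> V \<and> x \<notin> V"
proof (rule exists_valuation_ring_avoiding)
  show "poly h x \<noteq> 0" if "h \<noteq> 0" "\<And>i. coeff h i \<in> Fp_bar" for h
    using Fp_bar_algebraically_closed[OF prime char that] assms by blast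
qed (use Fp_bar_1 Fp_bar_diff Fp_bar_mult prime char in blast)+

lemma Prep_infinite_imp:
  assumes inf: "infinite (Prep F a b)" and a: "a \<notin> Fp_bar"
  shows "poly F a = poly F b"
proof (rule ccontr)
  assume neq: "poly F a \<noteq> poly F b"
  define N where "N = 3 * p ^ k"
  obtain S where S: "finite S" "card S = N" "S \<subseteq> Prep F a b"
    using infinite_arbitrarily_large[OF inf] by blast
  define \<Delta> where "\<Delta> = (poly F a - poly F b) ^ (N + 19) * (\<Prod>(t, t')\<in>S \<times> S - Id. t - t')"
  have "\<Delta> \<noteq> 0" using neq S(1) by (auto simp: \<Delta>_def prod_zero_iff)
  have place: "\<Delta> \<in> V \<and> (a \<notin> V \<longrightarrow> valuation_ring.vlt V \<Delta> 1)"
    if V: "valuation_ring V" "Fp_bar \<subseteq> V" for V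
  proof -
    interpret binomial_place V p l1 k s z u using binomial_place[OF V] .
    have f: "f x = poly F x" for x by (rule place_f[OF V])
    have cases_x: "(x \<in> V \<and> t \<in> V) \<or> (vlt 1 x \<and> veq t (x ^ (Q * e)) \<and> (\<forall>n. veq (orb t n x) x))"
      if "t \<in> S" "x = a \<or> x = b" for t x
      using that S(3) by (intro preperiodic_cases) (auto simp: Prep_def f)
    \<comment> \<open>The shared parameter transfers the case distinction from \<open>a\<close> to
      \<open>b\<close>: it is non-integral as soon as one starting point has a pole.\<close>
    have big: "t \<notin> V" if "vlt 1 x" "veq t (x ^ (Q * e))" for x t
    proof -
      have "Q * e > 0" using s_less_Q e_pos by simp
      hence "vlt 1 (x ^ (Q * e))" using vlt_power[OF that(1), of "Q * e"] by simp
      thus ?thesis using that(2) vlt_veq_trans veq_sym vlt_def vle_1_iff by blast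
    qed
    have "N > 0" using prime_gt_0_nat[OF prime] by (simp add: N_def)
    then obtain t0 where t0: "t0 \<in> S" using S by fastforce
    show ?thesis
    proof (cases "a \<in> V")
      case True
      hence t: "t \<in> V" if "t \<in> S" for t
        using cases_x[OF that, of a] by (auto simp: vlt_def vle_1_iff)
      hence "b \<in> V" using cases_x[OF t0, of b] big t0 by blast
      hence "poly F a \<in> V" "poly F b \<in> V" using f_small[OF True] f_small[of b] by (simp_all add: f)
      moreover have "(\<Prod>(t, t')\<in>S \<times> S - Id. t - t') \<in> V"
      proof (rule prod_mem)
        fix i assume "i \<in> S \<times> S - Id"
        thus "(case i of (t, t') \<Rightarrow> t - t') \<in> V" using t diff_mem by (cases i) auto
      qed
      ultimately have "\<Delta> \<in> V" unfolding \<Delta>_def by (intro mult_mem power_mem diff_mem)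
      thus ?thesis using True by simp
    next
      case False
      hence pole: "vlt 1 a" by (simp add: vlt_def vle_1_iff)
      have "p ^ k - 1 > 0" using s_less s_ge_3 by simp
      \<comment> \<open>Algebraic closedness provides an element of exactly the critical
        size.\<close>
      then obtain w where w: "w ^ (p ^ k - 1) = a ^ (s - 1)" using nth_root_exists by blast
      interpret binomial_pole V p l1 k s z u a w by unfold_locales (use pole w in auto)
      have ba: "bounded_at t a" "veq t (a ^ (Q * e))" if "t \<in> S" for t
        using cases_x[OF that, of a] False by (auto simp: bounded_at_def)
      have bb: "bounded_at t b" if "t \<in> S" for t
      proof -
        have "t \<notin> V" using big[OF pole] ba[OF that] by blast
        hence b: "vlt 1 b" "veq t (b ^ (Q * e))" "\<And>n. veq (orb t n b) b" using cases_x[OF that, of b] by auto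
        have "veq (b ^ (Q * e)) (a ^ (Q * e))" using ba(2)[OF that] b(2) veq_sym veq_trans by blast
        hence "veq b a" using veq_power_iff[of "Q * e"] s_less_Q e_pos by simp
        thus ?thesis using b(3) veq_trans unfolding bounded_at_def by blast
      qed
      have "card S = 3 * Q" using S(2) by (simp add: N_def Q_def)
      from discriminant_small[OF S(1) this ba(1) bb]
      have "vlt \<Delta> 1" by (simp add: \<Delta>_def N_def Q_def f)
      thus ?thesis using vlt_imp_vle vle_1_iff by blast
    qed
  qed
  \<comment> \<open>Integral everywhere, \<open>\<Delta>\<close> is a nonzero constant, hence a unit
    at every place; this contradicts its smallness at a pole of \<open>a\<close>.\<close>
  have "\<Delta> \<in> Fp_bar" using exists_place[of \<Delta>] place by blast
  obtain V where V: "valuation_ring V" "Fp_bar \<subseteq> V" "a \<notin> V" using exists_place[OF a] by blast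
  interpret valuation_ring V by fact
  have "vlt \<Delta> 1" using place V by blast
  moreover have "veq \<Delta> 1" by (rule Fp_bar_unit[OF V(1,2) \<open>\<Delta> \<in> Fp_bar\<close> \<open>\<Delta> \<noteq> 0\<close>])
  ultimately show False by (simp add: vlt_def veq_def)
qed

section \<open>Abundance of preperiodic parameters\<close>

lemma Fp_bar_preperiodic:
  assumes "x \<in> Fp_bar" "t \<in> Fp_bar"
  shows "preperiodic (\<lambda>x. poly F x + t) x"
proof -
  \<comment> \<open>All data lie in one finite field, which the orbit cannot leave.\<close>
  obtain n where n: "n > 0" "\<forall>y\<in>{x, t, c1, c2}. y ^ (p ^ n) = y"
    using Fp_bar_common_fixed[OF prime char, of "{x, t, c1, c2}"] assms c1 c2 by auto
  have frob: "(y + y') ^ (p ^ n) = y ^ (p ^ n) + y' ^ (p ^ n)" for y y' :: 'k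
    by (rule freshmans_dream'[where n = n]) (use prime char in auto)
  let ?h = "monom 1 (p ^ n) - monom 1 1 :: 'k poly"
  have "p ^ n > 1" using one_less_power[OF prime_gt_1_nat[OF prime] n(1)] .
  hence "coeff ?h (p ^ n) = 1" by simp
  hence "?h \<noteq> 0" by (metis coeff_0 zero_neq_one)
  hence "finite {y. poly ?h y = 0}" by (rule poly_roots_finite)
  hence fin: "finite {y. y ^ (p ^ n) = (y::'k)}" by (simp add: poly_monom)
  have "((\<lambda>x. poly F x + t) ^^ i) x ^ (p ^ n) = ((\<lambda>x. poly F x + t) ^^ i) x" for i
  proof (induction i)
    case (Suc i)
    let ?y = "((\<lambda>x. poly F x + t) ^^ i) x"
    have "(?y ^ d) ^ (p ^ n) = (?y ^ (p ^ n)) ^ d" for d by (simp only: mult.commute flip: power_mult)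
    hence "(?y ^ d) ^ (p ^ n) = ?y ^ d" for d unfolding Suc .
    thus ?case using n(2) by (simp add: F_def poly_monom frob power_mult_distrib)
  qed (use n in auto)
  thus ?thesis unfolding preperiodic_def by (intro finite_subset[OF _ fin]) auto
qed

text \<open>Needed when \<open>poly F a = poly F b\<close>: the two orbits then agree from the first
  iterate on.\<close>

lemma preperiodic_step: "preperiodic h x \<longleftrightarrow> preperiodic h (h x)"
proof -
  have "range (\<lambda>n. (h ^^ n) x) = insert x (range (\<lambda>n. (h ^^ n) (h x)))"
  proof (intro equalityI subsetI)
    fix y assume "y \<in> range (\<lambda>n. (h ^^ n) x)"
    then obtain n where "y = (h ^^ n) x" by blast
    thus "y \<in> insert x (range (\<lambda>n. (h ^^ n) (h x)))" by (cases n) (auto simp: funpow_swap1)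
  next
    fix y assume "y \<in> insert x (range (\<lambda>n. (h ^^ n) (h x)))"
    thus "y \<in> range (\<lambda>n. (h ^^ n) x)"
      using rangeI[of "\<lambda>n. (h ^^ n) x" 0] rangeI[of "\<lambda>n. (h ^^ n) x" "Suc _"]
      by (auto simp: funpow_swap1)
  qed
  thus ?thesis by (simp add: preperiodic_def)
qed

lemma periodic_imp_preperiodic:
  assumes "(h ^^ Suc n) x = x"
  shows "preperiodic h x"
proof -
  have "(h ^^ i) x \<in> (\<lambda>i. (h ^^ i) x) ` {..n}" for i
  proof (induction i)
    case (Suc i)
    then obtain j where j: "j \<le> n" "(h ^^ i) x = (h ^^ j) x" by auto
    hence "(h ^^ Suc i) x = (h ^^ Suc j) x" by simp
    moreover have "(h ^^ Suc j) x \<in> (\<lambda>i. (h ^^ i) x) ` {..n}"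
    proof (cases "j = n")
      case True
      thus ?thesis using assms by (intro image_eqI[of _ _ 0]) auto
    next
      case False
      thus ?thesis using j by (intro imageI) auto
    qed
    ultimately show ?case by simp
  qed (auto intro!: image_eqI[of _ _ 0])
  hence "range (\<lambda>i. (h ^^ i) x) \<subseteq> (\<lambda>i. (h ^^ i) x) ` {..n}" by (rule image_subsetI)
  thus ?thesis unfolding preperiodic_def by (rule finite_subset) simp
qed

text \<open>The \<open>n\<close>-th iterate of \<open>a\<close> as a polynomial in the parameter;
  the summand \<open>[:0, 1:]\<close> is that parameter.\<close>

primrec orbit_poly :: "'k \<Rightarrow> nat \<Rightarrow> 'k poly" where
  "orbit_poly a 0 = [:a:]"
| "orbit_poly a (Suc n) = pcompose F (orbit_poly a n) + [:0, 1:]"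

lemma poly_orbit_poly: "poly (orbit_poly a n) t = ((\<lambda>x. poly F x + t) ^^ n) a"
  by (induction n) (auto simp: poly_pcompose)

lemma degree_F: "degree F = p ^ l2"
proof -
  have "degree (monom c1 (p ^ l1 * s)) < degree (monom c2 (p ^ l2))"
    using less c2 by (intro le_less_trans[OF degree_monom_le]) (simp add: degree_monom_eq)
  thus ?thesis unfolding F_def using c2 by (simp add: degree_add_eq_right degree_monom_eq)
qed

lemma p_power_l2_gt_1: "p ^ l2 > 1"
  using one_less_power[OF prime_gt_1_nat[OF prime], of l2] l1_less_l2 by simp

text \<open>The first iterate is linear in the parameter. Each later step multiplies the degree by
  \<open>p ^ l2 > 1\<close>, so the added parameter never affects the leading term.\<close>

lemma degree_orbit_poly: "degree (orbit_poly a (Suc n)) = (p ^ l2) ^ n"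
proof (induction n)
  case 0
  have "pcompose F [:a:] = [:poly F a:]" by (simp add: pcompose_pCons_0)
  thus ?case by simp
next
  case (Suc n)
  have deg: "degree (pcompose F (orbit_poly a (Suc n))) = p ^ l2 * (p ^ l2) ^ n"
    using Suc degree_F by (simp add: degree_pcompose)
  have "p ^ l2 \<le> p ^ l2 * (p ^ l2) ^ n" using prime_gt_0_nat[OF prime] by simp
  hence "1 < p ^ l2 * (p ^ l2) ^ n" by (rule less_le_trans[OF p_power_l2_gt_1])
  moreover have "degree [:0, 1 :: 'k:] = 1" by simp
  ultimately have "degree [:0, 1 :: 'k:] < degree (pcompose F (orbit_poly a (Suc n)))"
    unfolding deg by (simp only:)
  thus ?case using deg by (simp only: orbit_poly.simps(2)[of a "Suc n"] degree_add_eq_left power_Suc)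
qed

lemma poly_pderiv_F: "poly (pderiv F) x = of_nat (p ^ l1 * s) * c1 * x ^ (p ^ l1 * s - 1)"
proof -
  have "of_nat (p ^ l2) = (0::'k)"
    using char l1_less_l2 by (simp add: of_nat_eq_0_iff_char_dvd dvd_power del: of_nat_power)
  thus ?thesis unfolding F_def
    by (simp add: pderiv_add pderiv_monom poly_monom del: of_nat_power of_nat_mult)
qed

text \<open>Parameters making \<open>a\<close> periodic with period dividing \<open>n + 1\<close>
  are the roots of a polynomial of degree \<open>(p ^ l2) ^ n > n\<close>. These roots are simple,
  contradicting a total of only \<open>n\<close> preperiodic parameters.\<close>

lemma infinite_preperiodic:
  assumes a: "a \<notin> Fp_bar"
  shows "infinite {t. preperiodic (\<lambda>x. poly F x + t) a}" (is "infinite ?T")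
proof
  assume fin: "finite ?T"
  obtain V where V: "valuation_ring V" "Fp_bar \<subseteq> V" "a \<notin> V" using exists_place[OF a] by blast
  interpret binomial_place V p l1 k s z u using binomial_place[OF V(1,2)] .
  have f: "f x = poly F x" for x by (rule place_f[OF V(1,2)])
  define n where "n = card ?T"
  define h where "h = orbit_poly a (Suc n) - [:a:]"
  have deg: "(p ^ l2) ^ n > n" using power_gt_expt[of "p ^ l2" n] p_power_l2_gt_1 by simp
  have root: "t \<in> ?T" "poly (pderiv h) t \<noteq> 0" if t: "poly h t = 0" for t
  proof -
    have "((\<lambda>x. poly F x + t) ^^ Suc n) a = a"
      using t unfolding h_def by (simp del: orbit_poly.simps funpow.simps add: poly_orbit_poly)
    hence pre: "preperiodic (\<lambda>x. poly F x + t) a" by (rule periodic_imp_preperiodic)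
    thus "t \<in> ?T" by simp
    have pole: "vlt 1 a" using V(3) by (simp add: vlt_def vle_1_iff)
    have orb: "veq (poly (orbit_poly a i) t) a" for i
      using preperiodic_cases[of t a] pre V(3) by (auto simp: f orb_def poly_orbit_poly)
    \<comment> \<open>The top term of \<open>F\<close> has zero derivative. The lower one
      contributes zero or a unit times a positive power of \<open>x\<close>, whose size exceeds
      1.\<close>
    have mult: "poly (pderiv F) x = 0 \<or> vlt 1 (poly (pderiv F) x)" if x: "veq x a" for x
    proof (cases "p dvd p ^ l1 * s")
      case True
      hence "of_nat (p ^ l1 * s) = (0::'k)" using char by (simp only: of_nat_eq_0_iff_char_dvd)
      thus ?thesis by (simp add: poly_pderiv_F del: of_nat_power of_nat_mult)
    next
      case False
      hence "veq (of_nat (p ^ l1 * s)) 1" by (rule unit_of_nat[OF prime char])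
      moreover have "veq c1 1" by (rule Fp_bar_unit[OF V(1,2) c1])
      ultimately have "veq (of_nat (p ^ l1 * s) * c1 * x ^ (p ^ l1 * s - 1)) (1 * 1 * a ^ (p ^ l1 * s - 1))"
        by (intro veq_mult veq_power x)
      moreover have "p ^ l1 * s \<ge> 1 * 3" using s_ge_3 prime_gt_0_nat[OF prime] by (intro mult_le_mono) auto
      hence "vlt (1 ^ (p ^ l1 * s - 1)) (a ^ (p ^ l1 * s - 1))" by (intro vlt_power[OF pole]) auto
      ultimately show ?thesis unfolding poly_pderiv_F using vlt_veq_trans veq_sym by fastforce
    qed
    \<comment> \<open>By the chain rule the parameter derivative \<open>B\<close> becomes
      \<open>m * B + 1\<close>, starting from 1. For \<open>m = 0\<close> this is 1, and for |m| > 1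
      the product dominates the summand 1.\<close>
    have "vle 1 (poly (pderiv (orbit_poly a (Suc i))) t)" for i
    proof (induction i)
      case 0
      have "pcompose F [:a:] = [:poly F a:]" by (simp add: pcompose_pCons_0)
      thus ?case by (simp add: pderiv_add pderiv_pCons)
    next
      case (Suc i)
      let ?m = "poly (pderiv F) (poly (orbit_poly a (Suc i)) t)"
      let ?B = "poly (pderiv (orbit_poly a (Suc i))) t"
      have B: "poly (pderiv (orbit_poly a (Suc (Suc i)))) t = ?m * ?B + 1"
        by (simp add: pderiv_add pderiv_pcompose poly_pcompose pderiv_pCons orbit_poly.simps(2)[of a "Suc i"]
            del: orbit_poly.simps)
      from mult[OF orb] have "?m = 0 \<or> vlt 1 ?m" .
      thus ?case
      proof
        assume "vlt 1 ?m"
        moreover have "?B \<noteq> 0" using Suc by auto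
        ultimately have "vlt (1 * 1) (?m * ?B)" using Suc by (intro vlt_vle_mult)
        hence "vlt 1 (?m * ?B)" by simp
        from vle_add_dominant[OF this] this show ?thesis unfolding B using vlt_imp_vle vle_trans by blast
      qed (simp only: B mult_zero_left add_0_left vle_refl)
    qed
    from this[of n] show "poly (pderiv h) t \<noteq> 0"
      unfolding h_def by (auto simp: pderiv_diff pderiv_pCons simp del: orbit_poly.simps)
  qed
  have degh: "degree h = (p ^ l2) ^ n"
  proof (cases "n = 0")
    case True
    have "pcompose F [:a:] = [:poly F a:]" by (simp add: pcompose_pCons_0)
    thus ?thesis using True by (simp add: h_def)
  next
    case False
    hence "degree [:- a:] < degree (orbit_poly a (Suc n))"
      unfolding degree_orbit_poly using deg prime_gt_0_nat[OF prime] by simp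
    hence "degree (orbit_poly a (Suc n) + [:- a:]) = (p ^ l2) ^ n"
      unfolding degree_orbit_poly[of a n, symmetric] by (rule degree_add_eq_left)
    moreover have "h = orbit_poly a (Suc n) + [:- a:]" by (simp add: h_def)
    ultimately show ?thesis by (simp only:)
  qed
  have "h \<noteq> 0" using degh prime_gt_0_nat[OF prime] by auto
  hence "card {t. poly h t = 0} = (p ^ l2) ^ n" using card_roots_separable[of h] root(2) degh by simp
  moreover have "card {t. poly h t = 0} \<le> n" unfolding n_def using root(1) by (intro card_mono fin) auto
  ultimately show False using deg by simp
qed

theorem infinite_Prep_iff:
  "infinite (Prep F a b) \<longleftrightarrow> (a \<in> Fp_bar \<and> b \<in> Fp_bar) \<or> poly F a = poly F b"
proof
  assume inf: "infinite (Prep F a b)"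
  have "Prep F b a = Prep F a b" by (auto simp: Prep_def)
  thus "(a \<in> Fp_bar \<and> b \<in> Fp_bar) \<or> poly F a = poly F b"
    using Prep_infinite_imp[of a b] Prep_infinite_imp[of b a] inf by metis
next
  have Fp: "infinite {t. preperiodic (\<lambda>x. poly F x + t) a}" for a
  proof (cases "a \<in> Fp_bar")
    case True
    hence "Fp_bar \<subseteq> {t. preperiodic (\<lambda>x. poly F x + t) a}" using Fp_bar_preperiodic by blast
    thus ?thesis using infinite_Fp_bar[OF prime char] infinite_super by blast
  qed (rule infinite_preperiodic)
  assume "(a \<in> Fp_bar \<and> b \<in> Fp_bar) \<or> poly F a = poly F b"
  thus "infinite (Prep F a b)"
  proof
    assume "a \<in> Fp_bar \<and> b \<in> Fp_bar"
    hence "Fp_bar \<subseteq> Prep F a b" using Fp_bar_preperiodic by (auto simp: Prep_def)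
    thus ?thesis using infinite_Fp_bar[OF prime char] infinite_super by blast
  next
    assume eq: "poly F a = poly F b"
    have "preperiodic (\<lambda>x. poly F x + t) a \<longleftrightarrow> preperiodic (\<lambda>x. poly F x + t) b" for t
      using preperiodic_step[of "\<lambda>x. poly F x + t" a] preperiodic_step[of "\<lambda>x. poly F x + t" b] eq by simp
    hence "Prep F a b = {t. preperiodic (\<lambda>x. poly F x + t) a}" by (auto simp: Prep_def)
    thus ?thesis using Fp by simp
  qed
qed

end

section \<open>Transfer to the algebraic closure\<close>

lemma CHAR_eq_of_ring_hom:
  fixes \<iota> :: "'l::field \<Rightarrow> 'k::field"
  assumes one: "\<iota> 1 = 1" and add: "\<And>x y. \<iota> (x + y) = \<iota> x + \<iota> y"
    and mult: "\<And>x y. \<iota> (x * y) = \<iota> x * \<iota> y"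
  shows "CHAR('k) = CHAR('l)"
proof -
  have zero: "\<iota> 0 = 0" using add[of 0 0] by (metis add_cancel_left_left add_0_left)
  have of_nat: "\<iota> (of_nat n) = of_nat n" for n by (induction n) (auto simp: zero one add)
  \<comment> \<open>Injectivity makes the same natural numbers vanish in both fields, so the
    characteristics divide each other.\<close>
  have "\<iota> x = 0 \<longleftrightarrow> x = 0" for x
    using mult[of x "inverse x"] one zero by (cases "x = 0") auto
  hence "of_nat n = (0::'k) \<longleftrightarrow> of_nat n = (0::'l)" for n using of_nat by metis
  hence "CHAR('k) dvd n \<longleftrightarrow> CHAR('l) dvd n" for n by (simp add: of_nat_eq_0_iff_char_dvd)
  thus ?thesis by (meson dvd_antisym dvd_refl)
qed

theorem theorem4p2:
  fixes p d1 d2 l1 l2 s1 s2 :: nat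
    and \<iota> :: "'l::field \<Rightarrow> 'k::alg_closed_field"
    and c1 c2 :: 'k
    and f :: "'k poly"
    and \<alpha> \<beta> :: 'l
  assumes "prime p" and "CHAR('l) = p"
    and "algebraic_closure_map \<iota>"
    and "c1 \<in> Fp_bar" and "c1 \<noteq> 0" and "c2 \<in> Fp_bar" and "c2 \<noteq> 0"
    and "f = monom c1 d1 + monom c2 d2"
    and "1 \<le> d1" and "d1 < d2"
    and "d1 = p ^ l1 * s1" and "\<not> p dvd s1"
    and "d2 = p ^ l2 * s2" and "\<not> p dvd s2"
    and "s1 \<ge> 3" and "s2 = 1"
  shows "infinite (Prep f (\<iota> \<alpha>) (\<iota> \<beta>)) \<longleftrightarrow>
           (\<iota> \<alpha> \<in> Fp_bar \<and> \<iota> \<beta> \<in> Fp_bar) \<or> poly f (\<iota> \<alpha>) = poly f (\<iota> \<beta>)"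
proof -
  have "CHAR('k) = p"
    using assms(2,3) CHAR_eq_of_ring_hom[of \<iota>] by (auto simp: algebraic_closure_map_def)
  then interpret binomial_family p l1 l2 s1 c1 c2
    using assms by unfold_locales auto
  \<comment> \<open>The condition \<open>s2 = 1\<close> makes the higher exponent the pure power
    \<open>p ^ l2\<close>.\<close>
  have "f = F" using assms by (simp add: F_def)
  thus ?thesis using infinite_Prep_iff by simp
qed

end
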